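(* Let $F$ be a formula which contains no occurrences of nominal constants. Then $F$ is provable in $FO\lambda^{\Delta\nabla}$-style logic $FO\lambda^{\nabla}$ (the core system below) extended with the axiom schemes $B\equiv\nabla x.B$ (for $x$ not free in $B$) and $\nabla x\nabla y.B\,x\,y\supset\nabla y\nabla x.B\,x\,y$ if and only if $F$ is provable in $LG$.
   Context: $B\equiv C$ abbreviates $(B\supset C)\land(C\supset B)$. $LG$: simply typed terms, formulas of type $o$, distinguished nominal types each with infinitely many nominal constants, other constants $\mathcal K$; permutations $\pi$ (finite type-preserving bijections of nominal constants) act by $\pi.t$; $supp(t)$ = nominal constants in $t$. Sequents $\Sigma;\Gamma\vdash C$. Rules of $LG$: $id_\pi$ ($\Sigma;\Gamma,B\vdash B'$ if $\pi.B=\pi'.B'$ for some permutations), multicut, contraction, $\bot L$, $\top R$, usual intuitionistic $\land,\lor,\supset$ rules, $\forall L/\exists R$ with any well-typed term (over $\Sigma$, $\mathcal K$, nominal constants), $\forall R/\exists L$ with a fresh variable $h$ raised over the list $\vec c$ of $supp(B)$ (premise uses $B[h\,\vec c/x]$), $\nabla L/\nabla R$ replacing the bound variable by a nominal constant $a\notin supp(B)$. $F$ is provable in $LG$ if $\Sigma;\cdot\vdash F$ is derivable, $\Sigma$ containing the free variables of $F$. Core system $FO\lambda^{\nabla}$ (Miller–Tiu, without definitions/equality): sequents $\Sigma;\sigma_1\triangleright B_1,\dots,\sigma_n\triangleright B_n\vdash\sigma_0\triangleright B_0$ where local signatures $\sigma_i$ are lists of variables scoped over $B_i$, judgments identified up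 to renaming of local signatures. Rules: $id$, $cut$, contraction and weakening on the left, $\bot L$, $\top R$, $\land,\lor,\supset$ rules acting on judgments with a common local signature, $\forall L/\exists R$ instantiating with terms typable from $\Sigma,\sigma$, $\forall R/\exists L$ using a fresh $h$ raised over $\sigma$ (i.e. $B[(h\,\sigma)/x]$), $\nabla L/\nabla R$: $\sigma\triangleright\nabla x.B$ is introduced from $(\sigma,y)\triangleright B[y/x]$ with $y$ new. $F$ is provable there if $\Sigma;\cdot\vdash()\triangleright F$ is derivable. The extension with the two axiom schemes is equivalently presented by adding, on both sides of the sequent, the rules: exchange of two adjacent variables in a local signature; removal of a variable from a local signature (from $(\vec x,a,\vec y)\triangleright B$ infer $(\vec x,\vec y)\triangleright B$); and addition of a vacuous variable (from $(\vec x,\vec y)\triangleright B$ infer $(\vec x,a,\vec y)\triangleright B$ for $a$ not occurring in $B$). *)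

theory Defs
  imports "HOL-Library.Multiset"
begin

section \<open>Simply typed terms\<close>

text \<open>The type \<open>o\<close> of formulas is the constructor \<open>Prop\<close>; the other base types are the elements
  of \<open>'b\<close>.\<close>

datatype 'b ty = Prop | Base 'b | Fn "'b ty" "'b ty" (infixr "\<rightarrow>" 65)

fun prop_free :: "'b ty \<Rightarrow> bool" where
  "prop_free Prop = False"
| "prop_free (Base b) = True"
| "prop_free (\<tau> \<rightarrow> \<rho>) = (prop_free \<tau> \<and> prop_free \<rho>)"

text \<open>A language fixes the nominal types and the typed non-logical constants (the set \<open>K\<close> is
  the type \<open>'k\<close>).\<close>

record ('b, 'k) lang =
  nominal :: "'b ty set"
  const_ty :: "'k \<Rightarrow> 'b ty"

text \<open>Quantifiers, and hence \<open>\<nabla>\<close>, only range over types in which \<open>o\<close> does not occur.\<close>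

definition wf_lang :: "('b, 'k) lang \<Rightarrow> bool" where
  "wf_lang S \<longleftrightarrow> (\<forall>\<tau> \<in> nominal S. prop_free \<tau>)"

datatype 'b logical =
  Falsum | Verum | Conj | Disj | Impl | Forall "'b ty" | Exists "'b ty" | Nabla "'b ty"

fun logical_ty :: "'b logical \<Rightarrow> 'b ty" where
  "logical_ty Falsum = Prop"
| "logical_ty Verum = Prop"
| "logical_ty Conj = Prop \<rightarrow> Prop \<rightarrow> Prop"
| "logical_ty Disj = Prop \<rightarrow> Prop \<rightarrow> Prop"
| "logical_ty Impl = Prop \<rightarrow> Prop \<rightarrow> Prop"
| "logical_ty (Forall \<tau>) = (\<tau> \<rightarrow> Prop) \<rightarrow> Prop"
| "logical_ty (Exists \<tau>) = (\<tau> \<rightarrow> Prop) \<rightarrow> Prop"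
| "logical_ty (Nabla \<tau>) = (\<tau> \<rightarrow> Prop) \<rightarrow> Prop"

fun logical_ok :: "('b, 'k) lang \<Rightarrow> 'b logical \<Rightarrow> bool" where
  "logical_ok S (Forall \<tau>) = prop_free \<tau>"
| "logical_ok S (Exists \<tau>) = prop_free \<tau>"
| "logical_ok S (Nabla \<tau>) = (\<tau> \<in> nominal S)"
| "logical_ok S _ = True"

text \<open>Church-style names: a variable or a nominal constant is an index together with its type, so
  there are infinitely many of each type. Bound variables are de Bruijn indices; the variables of a
  local signature are represented by de Bruijn indices as well.\<close>

type_synonym 'b name = "nat \<times> 'b ty"

datatype ('b, 'k) tm =
  Bnd nat
| Var "'b name"
| Nom "'b name"
| Con 'k
| Log "'b logical"
| App "('b, 'k) tm" "('b, 'k) tm" (infixl "\<cdot>" 80)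
| Lam "'b ty" "('b, 'k) tm"

primrec fv :: "('b, 'k) tm \<Rightarrow> 'b name set" where
  "fv (Bnd i) = {}"
| "fv (Var x) = {x}"
| "fv (Nom a) = {}"
| "fv (Con k) = {}"
| "fv (Log c) = {}"
| "fv (t \<cdot> u) = fv t \<union> fv u"
| "fv (Lam \<tau> t) = fv t"

primrec supp :: "('b, 'k) tm \<Rightarrow> 'b name set" where
  "supp (Bnd i) = {}"
| "supp (Var x) = {}"
| "supp (Nom a) = {a}"
| "supp (Con k) = {}"
| "supp (Log c) = {}"
| "supp (t \<cdot> u) = supp t \<union> supp u"
| "supp (Lam \<tau> t) = supp t"

definition is_perm :: "('b name \<Rightarrow> 'b name) \<Rightarrow> bool" where
  "is_perm \<pi> \<longleftrightarrow> bij \<pi> \<and> finite {a. \<pi> a \<noteq> a} \<and> (\<forall>a. snd (\<pi> a) = snd a)"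

primrec perm :: "('b name \<Rightarrow> 'b name) \<Rightarrow> ('b, 'k) tm \<Rightarrow> ('b, 'k) tm" where
  "perm \<pi> (Bnd i) = Bnd i"
| "perm \<pi> (Var x) = Var x"
| "perm \<pi> (Nom a) = Nom (\<pi> a)"
| "perm \<pi> (Con k) = Con k"
| "perm \<pi> (Log c) = Log c"
| "perm \<pi> (t \<cdot> u) = perm \<pi> t \<cdot> perm \<pi> u"
| "perm \<pi> (Lam \<tau> t) = Lam \<tau> (perm \<pi> t)"

primrec ren :: "(nat \<Rightarrow> nat) \<Rightarrow> ('b, 'k) tm \<Rightarrow> ('b, 'k) tm" where
  "ren f (Bnd i) = Bnd (f i)"
| "ren f (Var x) = Var x"
| "ren f (Nom a) = Nom a"
| "ren f (Con k) = Con k"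
| "ren f (Log c) = Log c"
| "ren f (t \<cdot> u) = ren f t \<cdot> ren f u"
| "ren f (Lam \<tau> t) = Lam \<tau> (ren (case_nat 0 (\<lambda>i. Suc (f i))) t)"

primrec sub :: "(nat \<Rightarrow> ('b, 'k) tm) \<Rightarrow> ('b, 'k) tm \<Rightarrow> ('b, 'k) tm" where
  "sub s (Bnd i) = s i"
| "sub s (Var x) = Var x"
| "sub s (Nom a) = Nom a"
| "sub s (Con k) = Con k"
| "sub s (Log c) = Log c"
| "sub s (t \<cdot> u) = sub s t \<cdot> sub s u"
| "sub s (Lam \<tau> t) = Lam \<tau> (sub (case_nat (Bnd 0) (\<lambda>i. ren Suc (s i))) t)"

text \<open>\<open>B[t/x]\<close> for the outermost bound variable \<open>x\<close> of the body \<open>B\<close>, i.e. index 0.\<close>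

definition inst :: "('b, 'k) tm \<Rightarrow> ('b, 'k) tm \<Rightarrow> ('b, 'k) tm" where
  "inst B t = sub (case_nat t Bnd) B"

text \<open>In a typing context \<open>\<Delta>\<close>, the type of index \<open>i\<close> is \<open>\<Delta> ! i\<close>.\<close>

inductive typed :: "('b, 'k) lang \<Rightarrow> 'b ty list \<Rightarrow> ('b, 'k) tm \<Rightarrow> 'b ty \<Rightarrow> bool" for S where
  "i < length \<Delta> \<Longrightarrow> typed S \<Delta> (Bnd i) (\<Delta> ! i)"
| "typed S \<Delta> (Var x) (snd x)"
| "snd a \<in> nominal S \<Longrightarrow> typed S \<Delta> (Nom a) (snd a)"
| "typed S \<Delta> (Con k) (const_ty S k)"
| "logical_ok S c \<Longrightarrow> typed S \<Delta> (Log c) (logical_ty c)"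
| "typed S \<Delta> t (\<tau> \<rightarrow> \<rho>) \<Longrightarrow> typed S \<Delta> u \<tau> \<Longrightarrow> typed S \<Delta> (t \<cdot> u) \<rho>"
| "typed S (\<tau> # \<Delta>) t \<rho> \<Longrightarrow> typed S \<Delta> (Lam \<tau> t) (\<tau> \<rightarrow> \<rho>)"

inductive conv :: "('b, 'k) tm \<Rightarrow> ('b, 'k) tm \<Rightarrow> bool" where
  beta: "conv (Lam \<tau> t \<cdot> u) (inst t u)"
| eta: "conv (Lam \<tau> (ren Suc t \<cdot> Bnd 0)) t"
| app: "conv t t' \<Longrightarrow> conv u u' \<Longrightarrow> conv (t \<cdot> u) (t' \<cdot> u')"
| lam: "conv t t' \<Longrightarrow> conv (Lam \<tau> t) (Lam \<tau> t')"
| refl: "conv t t"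
| sym: "conv t u \<Longrightarrow> conv u t"
| trans: "conv t u \<Longrightarrow> conv u v \<Longrightarrow> conv t v"

text \<open>Well-typed \<open>\<beta>\<eta>\<close>-long normal forms; \<open>neutral\<close> terms are heads applied to such forms.\<close>

inductive long_nf :: "('b, 'k) lang \<Rightarrow> 'b ty list \<Rightarrow> ('b, 'k) tm \<Rightarrow> 'b ty \<Rightarrow> bool"
  and neutral :: "('b, 'k) lang \<Rightarrow> 'b ty list \<Rightarrow> ('b, 'k) tm \<Rightarrow> 'b ty \<Rightarrow> bool" for S where
  "long_nf S (\<tau> # \<Delta>) t \<rho> \<Longrightarrow> long_nf S \<Delta> (Lam \<tau> t) (\<tau> \<rightarrow> \<rho>)"
| "neutral S \<Delta> t Prop \<Longrightarrow> long_nf S \<Delta> t Prop"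
| "neutral S \<Delta> t (Base b) \<Longrightarrow> long_nf S \<Delta> t (Base b)"
| "i < length \<Delta> \<Longrightarrow> neutral S \<Delta> (Bnd i) (\<Delta> ! i)"
| "neutral S \<Delta> (Var x) (snd x)"
| "snd a \<in> nominal S \<Longrightarrow> neutral S \<Delta> (Nom a) (snd a)"
| "neutral S \<Delta> (Con k) (const_ty S k)"
| "logical_ok S c \<Longrightarrow> neutral S \<Delta> (Log c) (logical_ty c)"
| "neutral S \<Delta> t (\<tau> \<rightarrow> \<rho>) \<Longrightarrow> long_nf S \<Delta> u \<tau> \<Longrightarrow> neutral S \<Delta> (t \<cdot> u) \<rho>"

text \<open>Formulas in sequents are \<open>\<beta>\<eta>\<close>-long normal forms of type \<open>o\<close>, so that equality modulo
  \<open>\<alpha>\<beta>\<eta>\<close> is syntactic equality. \<open>inst_nf S \<Delta> B t B'\<close> says that \<open>B'\<close> is the normal form of \<open>B[t/x]\<close>.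
  No normalization is needed when \<open>t\<close> is a nominal constant, as it only replaces heads.\<close>

definition inst_nf ::
  "('b, 'k) lang \<Rightarrow> 'b ty list \<Rightarrow> ('b, 'k) tm \<Rightarrow> ('b, 'k) tm \<Rightarrow> ('b, 'k) tm \<Rightarrow> bool" where
  "inst_nf S \<Delta> B t B' \<longleftrightarrow> conv (inst B t) B' \<and> long_nf S \<Delta> B' Prop"

abbreviation FFalse :: "('b, 'k) tm" where "FFalse \<equiv> Log Falsum"
abbreviation FTrue :: "('b, 'k) tm" where "FTrue \<equiv> Log Verum"
abbreviation FAnd :: "('b, 'k) tm \<Rightarrow> ('b, 'k) tm \<Rightarrow> ('b, 'k) tm" where
  "FAnd B C \<equiv> Log Conj \<cdot> B \<cdot> C"
abbreviation FOr :: "('b, 'k) tm \<Rightarrow> ('b, 'k) tm \<Rightarrow> ('b, 'k) tm" where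
  "FOr B C \<equiv> Log Disj \<cdot> B \<cdot> C"
abbreviation FImp :: "('b, 'k) tm \<Rightarrow> ('b, 'k) tm \<Rightarrow> ('b, 'k) tm" where
  "FImp B C \<equiv> Log Impl \<cdot> B \<cdot> C"
abbreviation FAll :: "'b ty \<Rightarrow> ('b, 'k) tm \<Rightarrow> ('b, 'k) tm" where
  "FAll \<tau> B \<equiv> Log (Forall \<tau>) \<cdot> Lam \<tau> B"
abbreviation FEx :: "'b ty \<Rightarrow> ('b, 'k) tm \<Rightarrow> ('b, 'k) tm" where
  "FEx \<tau> B \<equiv> Log (Exists \<tau>) \<cdot> Lam \<tau> B"
abbreviation FNab :: "'b ty \<Rightarrow> ('b, 'k) tm \<Rightarrow> ('b, 'k) tm" where
  "FNab \<tau> B \<equiv> Log (Nabla \<tau>) \<cdot> Lam \<tau> B"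

definition FEquiv :: "('b, 'k) tm \<Rightarrow> ('b, 'k) tm \<Rightarrow> ('b, 'k) tm" where
  "FEquiv B C = FAnd (FImp B C) (FImp C B)"

definition apps :: "('b, 'k) tm \<Rightarrow> ('b, 'k) tm list \<Rightarrow> ('b, 'k) tm" where
  "apps t us = foldl App t us"

definition fns :: "'b ty list \<Rightarrow> 'b ty \<Rightarrow> 'b ty" where
  "fns \<tau>s \<rho> = foldr Fn \<tau>s \<rho>"


section \<open>The logic LG\<close>

definition formula :: "('b, 'k) lang \<Rightarrow> 'b name set \<Rightarrow> ('b, 'k) tm \<Rightarrow> bool" where
  "formula S \<Sigma> B \<longleftrightarrow> long_nf S [] B Prop \<and> fv B \<subseteq> \<Sigma>"

definition wf_LG ::
  "('b, 'k) lang \<Rightarrow> 'b name set \<Rightarrow> ('b, 'k) tm multiset \<Rightarrow> ('b, 'k) tm \<Rightarrow> bool" where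
  "wf_LG S \<Sigma> \<Gamma> C \<longleftrightarrow> finite \<Sigma> \<and> (\<forall>B \<in># \<Gamma>. formula S \<Sigma> B) \<and> formula S \<Sigma> C"

inductive LG ::
  "('b, 'k) lang \<Rightarrow> 'b name set \<Rightarrow> ('b, 'k) tm multiset \<Rightarrow> ('b, 'k) tm \<Rightarrow> bool" for S where
  id_perm: "wf_LG S \<Sigma> (add_mset B \<Gamma>) B' \<Longrightarrow>
    is_perm \<pi> \<Longrightarrow> is_perm \<pi>' \<Longrightarrow> perm \<pi> B = perm \<pi>' B' \<Longrightarrow> LG S \<Sigma> (add_mset B \<Gamma>) B'"
| multicut: "wf_LG S \<Sigma> (sum_list \<Delta>s + \<Gamma>) C \<Longrightarrow> length \<Delta>s = length Bs \<Longrightarrow>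
    (\<And>i. i < length Bs \<Longrightarrow> LG S \<Sigma> (\<Delta>s ! i) (Bs ! i)) \<Longrightarrow> LG S \<Sigma> (mset Bs + \<Gamma>) C \<Longrightarrow>
    LG S \<Sigma> (sum_list \<Delta>s + \<Gamma>) C"
| contrL: "wf_LG S \<Sigma> (add_mset B \<Gamma>) C \<Longrightarrow>
    LG S \<Sigma> (add_mset B (add_mset B \<Gamma>)) C \<Longrightarrow> LG S \<Sigma> (add_mset B \<Gamma>) C"
| FalseL: "wf_LG S \<Sigma> (add_mset FFalse \<Gamma>) C \<Longrightarrow> LG S \<Sigma> (add_mset FFalse \<Gamma>) C"
| TrueR: "wf_LG S \<Sigma> \<Gamma> FTrue \<Longrightarrow> LG S \<Sigma> \<Gamma> FTrue"
| AndL1: "wf_LG S \<Sigma> (add_mset (FAnd B D) \<Gamma>) C \<Longrightarrow>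
    LG S \<Sigma> (add_mset B \<Gamma>) C \<Longrightarrow> LG S \<Sigma> (add_mset (FAnd B D) \<Gamma>) C"
| AndL2: "wf_LG S \<Sigma> (add_mset (FAnd B D) \<Gamma>) C \<Longrightarrow>
    LG S \<Sigma> (add_mset D \<Gamma>) C \<Longrightarrow> LG S \<Sigma> (add_mset (FAnd B D) \<Gamma>) C"
| AndR: "wf_LG S \<Sigma> \<Gamma> (FAnd B C) \<Longrightarrow>
    LG S \<Sigma> \<Gamma> B \<Longrightarrow> LG S \<Sigma> \<Gamma> C \<Longrightarrow> LG S \<Sigma> \<Gamma> (FAnd B C)"
| OrL: "wf_LG S \<Sigma> (add_mset (FOr B D) \<Gamma>) C \<Longrightarrow>
    LG S \<Sigma> (add_mset B \<Gamma>) C \<Longrightarrow> LG S \<Sigma> (add_mset D \<Gamma>) C \<Longrightarrow>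
    LG S \<Sigma> (add_mset (FOr B D) \<Gamma>) C"
| OrR1: "wf_LG S \<Sigma> \<Gamma> (FOr B C) \<Longrightarrow> LG S \<Sigma> \<Gamma> B \<Longrightarrow> LG S \<Sigma> \<Gamma> (FOr B C)"
| OrR2: "wf_LG S \<Sigma> \<Gamma> (FOr B C) \<Longrightarrow> LG S \<Sigma> \<Gamma> C \<Longrightarrow> LG S \<Sigma> \<Gamma> (FOr B C)"
| ImpL: "wf_LG S \<Sigma> (add_mset (FImp B D) \<Gamma>) C \<Longrightarrow>
    LG S \<Sigma> \<Gamma> B \<Longrightarrow> LG S \<Sigma> (add_mset D \<Gamma>) C \<Longrightarrow> LG S \<Sigma> (add_mset (FImp B D) \<Gamma>) C"
| ImpR: "wf_LG S \<Sigma> \<Gamma> (FImp B C) \<Longrightarrow> LG S \<Sigma> (add_mset B \<Gamma>) C \<Longrightarrow> LG S \<Sigma> \<Gamma> (FImp B C)"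
| AllL: "wf_LG S \<Sigma> (add_mset (FAll \<tau> B) \<Gamma>) C \<Longrightarrow>
    typed S [] t \<tau> \<Longrightarrow> fv t \<subseteq> \<Sigma> \<Longrightarrow> inst_nf S [] B t B' \<Longrightarrow>
    LG S \<Sigma> (add_mset B' \<Gamma>) C \<Longrightarrow> LG S \<Sigma> (add_mset (FAll \<tau> B) \<Gamma>) C"
| AllR: "wf_LG S \<Sigma> \<Gamma> (FAll \<tau> B) \<Longrightarrow>
    distinct cs \<Longrightarrow> set cs = supp B \<Longrightarrow> h = (n, fns (map snd cs) \<tau>) \<Longrightarrow> h \<notin> \<Sigma> \<Longrightarrow>
    inst_nf S [] B (apps (Var h) (map Nom cs)) B' \<Longrightarrow>
    LG S (insert h \<Sigma>) \<Gamma> B' \<Longrightarrow> LG S \<Sigma> \<Gamma> (FAll \<tau> B)"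
| ExL: "wf_LG S \<Sigma> (add_mset (FEx \<tau> B) \<Gamma>) C \<Longrightarrow>
    distinct cs \<Longrightarrow> set cs = supp B \<Longrightarrow> h = (n, fns (map snd cs) \<tau>) \<Longrightarrow> h \<notin> \<Sigma> \<Longrightarrow>
    inst_nf S [] B (apps (Var h) (map Nom cs)) B' \<Longrightarrow>
    LG S (insert h \<Sigma>) (add_mset B' \<Gamma>) C \<Longrightarrow> LG S \<Sigma> (add_mset (FEx \<tau> B) \<Gamma>) C"
| ExR: "wf_LG S \<Sigma> \<Gamma> (FEx \<tau> B) \<Longrightarrow>
    typed S [] t \<tau> \<Longrightarrow> fv t \<subseteq> \<Sigma> \<Longrightarrow> inst_nf S [] B t B' \<Longrightarrow>
    LG S \<Sigma> \<Gamma> B' \<Longrightarrow> LG S \<Sigma> \<Gamma> (FEx \<tau> B)"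
| NabL: "wf_LG S \<Sigma> (add_mset (FNab \<tau> B) \<Gamma>) C \<Longrightarrow>
    (n, \<tau>) \<notin> supp B \<Longrightarrow> LG S \<Sigma> (add_mset (inst B (Nom (n, \<tau>))) \<Gamma>) C \<Longrightarrow>
    LG S \<Sigma> (add_mset (FNab \<tau> B) \<Gamma>) C"
| NabR: "wf_LG S \<Sigma> \<Gamma> (FNab \<tau> B) \<Longrightarrow>
    (n, \<tau>) \<notin> supp B \<Longrightarrow> LG S \<Sigma> \<Gamma> (inst B (Nom (n, \<tau>))) \<Longrightarrow> LG S \<Sigma> \<Gamma> (FNab \<tau> B)"

definition LG_provable :: "('b, 'k) lang \<Rightarrow> 'b name set \<Rightarrow> ('b, 'k) tm \<Rightarrow> bool" where
  "LG_provable S \<Sigma> F \<longleftrightarrow> LG S \<Sigma> {#} F"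


section \<open>The logic \<open>FO\<lambda>\<nabla>\<close> with the two axiom schemes\<close>

text \<open>A generic judgement \<open>\<sigma> \<triangleright> B\<close> is a pair \<open>(\<sigma>, B)\<close>: the local signature is the list of the types
  of its variables, most recent first, and index \<open>i\<close> in \<open>B\<close> denotes the variable of type \<open>\<sigma> ! i\<close>.
  Judgements that differ in the names of their local variables are therefore equal. As \<open>\<nabla>\<close>
  only quantifies over nominal types, local variables have nominal types. There are no nominal
  constants in this logic.\<close>

type_synonym ('b, 'k) gjudgment = "'b ty list \<times> ('b, 'k) tm"

fun wf_judgment :: "('b, 'k) lang \<Rightarrow> 'b name set \<Rightarrow> ('b, 'k) gjudgment \<Rightarrow> bool" where
  "wf_judgment S \<Sigma> (\<sigma>, B) \<longleftrightarrow>
     set \<sigma> \<subseteq> nominal S \<and> long_nf S \<sigma> B Prop \<and> fv B \<subseteq> \<Sigma> \<and> supp B = {}"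

definition wf_FO ::
  "('b, 'k) lang \<Rightarrow> 'b name set \<Rightarrow> ('b, 'k) gjudgment multiset \<Rightarrow> ('b, 'k) gjudgment \<Rightarrow> bool" where
  "wf_FO S \<Sigma> \<Gamma> J \<longleftrightarrow> finite \<Sigma> \<and> (\<forall>I \<in># \<Gamma>. wf_judgment S \<Sigma> I) \<and> wf_judgment S \<Sigma> J"

text \<open>\<open>local_term S \<Sigma> \<sigma> t \<tau>\<close>: the term \<open>t\<close> has type \<open>\<tau>\<close> over \<open>\<Sigma>\<close>, \<open>\<sigma>\<close> and the constants
  \<open>K\<close>.\<close>

definition local_term ::
  "('b, 'k) lang \<Rightarrow> 'b name set \<Rightarrow> 'b ty list \<Rightarrow> ('b, 'k) tm \<Rightarrow> 'b ty \<Rightarrow> bool" where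
  "local_term S \<Sigma> \<sigma> t \<tau> \<longleftrightarrow> typed S \<sigma> t \<tau> \<and> fv t \<subseteq> \<Sigma> \<and> supp t = {}"

text \<open>All variables of the local signature \<open>\<sigma>\<close>, oldest first.\<close>

definition local_vars :: "'b ty list \<Rightarrow> ('b, 'k) tm list" where
  "local_vars \<sigma> = map Bnd (rev [0..<length \<sigma>])"

text \<open>\<open>B \<equiv> \<nabla>x. B\<close> with \<open>x\<close> not free in \<open>B\<close> (expressed by \<open>ren Suc\<close>), and
  \<open>\<nabla>x \<nabla>y. B x y \<supset> \<nabla>y \<nabla>x. B x y\<close>: on the right the indices 0 and 1 are exchanged since the order of
  the binders is. Instances that are not well-typed are excluded by the well-formedness of sequents.\<close>

inductive nabla_axiom :: "('b, 'k) tm \<Rightarrow> bool" where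
  vacuous: "nabla_axiom (FEquiv B (FNab \<tau> (ren Suc B)))"
| exchange: "nabla_axiom
    (FImp (FNab \<tau> (FNab \<rho> B)) (FNab \<rho> (FNab \<tau> (ren (id(0 := 1, 1 := 0)) B))))"

inductive FO_nabla ::
  "('b, 'k) lang \<Rightarrow> 'b name set \<Rightarrow> ('b, 'k) gjudgment multiset \<Rightarrow> ('b, 'k) gjudgment \<Rightarrow> bool"
  for S where
  axiom: "wf_FO S \<Sigma> \<Gamma> (\<sigma>, A) \<Longrightarrow> nabla_axiom A \<Longrightarrow> FO_nabla S \<Sigma> \<Gamma> (\<sigma>, A)"
| id: "wf_FO S \<Sigma> (add_mset J \<Gamma>) J \<Longrightarrow> FO_nabla S \<Sigma> (add_mset J \<Gamma>) J"
| cut: "wf_FO S \<Sigma> (\<Delta> + \<Gamma>) J \<Longrightarrow>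
    FO_nabla S \<Sigma> \<Delta> I \<Longrightarrow> FO_nabla S \<Sigma> (add_mset I \<Gamma>) J \<Longrightarrow> FO_nabla S \<Sigma> (\<Delta> + \<Gamma>) J"
| contrL: "wf_FO S \<Sigma> (add_mset I \<Gamma>) J \<Longrightarrow>
    FO_nabla S \<Sigma> (add_mset I (add_mset I \<Gamma>)) J \<Longrightarrow> FO_nabla S \<Sigma> (add_mset I \<Gamma>) J"
| weakL: "wf_FO S \<Sigma> (add_mset I \<Gamma>) J \<Longrightarrow>
    FO_nabla S \<Sigma> \<Gamma> J \<Longrightarrow> FO_nabla S \<Sigma> (add_mset I \<Gamma>) J"
| FalseL: "wf_FO S \<Sigma> (add_mset (\<sigma>, FFalse) \<Gamma>) J \<Longrightarrow>
    FO_nabla S \<Sigma> (add_mset (\<sigma>, FFalse) \<Gamma>) J"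
| TrueR: "wf_FO S \<Sigma> \<Gamma> (\<sigma>, FTrue) \<Longrightarrow> FO_nabla S \<Sigma> \<Gamma> (\<sigma>, FTrue)"
| AndL1: "wf_FO S \<Sigma> (add_mset (\<sigma>, FAnd B D) \<Gamma>) J \<Longrightarrow>
    FO_nabla S \<Sigma> (add_mset (\<sigma>, B) \<Gamma>) J \<Longrightarrow> FO_nabla S \<Sigma> (add_mset (\<sigma>, FAnd B D) \<Gamma>) J"
| AndL2: "wf_FO S \<Sigma> (add_mset (\<sigma>, FAnd B D) \<Gamma>) J \<Longrightarrow>
    FO_nabla S \<Sigma> (add_mset (\<sigma>, D) \<Gamma>) J \<Longrightarrow> FO_nabla S \<Sigma> (add_mset (\<sigma>, FAnd B D) \<Gamma>) J"
| AndR: "wf_FO S \<Sigma> \<Gamma> (\<sigma>, FAnd B C) \<Longrightarrow>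
    FO_nabla S \<Sigma> \<Gamma> (\<sigma>, B) \<Longrightarrow> FO_nabla S \<Sigma> \<Gamma> (\<sigma>, C) \<Longrightarrow> FO_nabla S \<Sigma> \<Gamma> (\<sigma>, FAnd B C)"
| OrL: "wf_FO S \<Sigma> (add_mset (\<sigma>, FOr B D) \<Gamma>) J \<Longrightarrow>
    FO_nabla S \<Sigma> (add_mset (\<sigma>, B) \<Gamma>) J \<Longrightarrow> FO_nabla S \<Sigma> (add_mset (\<sigma>, D) \<Gamma>) J \<Longrightarrow>
    FO_nabla S \<Sigma> (add_mset (\<sigma>, FOr B D) \<Gamma>) J"
| OrR1: "wf_FO S \<Sigma> \<Gamma> (\<sigma>, FOr B C) \<Longrightarrow>
    FO_nabla S \<Sigma> \<Gamma> (\<sigma>, B) \<Longrightarrow> FO_nabla S \<Sigma> \<Gamma> (\<sigma>, FOr B C)"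
| OrR2: "wf_FO S \<Sigma> \<Gamma> (\<sigma>, FOr B C) \<Longrightarrow>
    FO_nabla S \<Sigma> \<Gamma> (\<sigma>, C) \<Longrightarrow> FO_nabla S \<Sigma> \<Gamma> (\<sigma>, FOr B C)"
| ImpL: "wf_FO S \<Sigma> (add_mset (\<sigma>, FImp B D) \<Gamma>) J \<Longrightarrow>
    FO_nabla S \<Sigma> \<Gamma> (\<sigma>, B) \<Longrightarrow> FO_nabla S \<Sigma> (add_mset (\<sigma>, D) \<Gamma>) J \<Longrightarrow>
    FO_nabla S \<Sigma> (add_mset (\<sigma>, FImp B D) \<Gamma>) J"
| ImpR: "wf_FO S \<Sigma> \<Gamma> (\<sigma>, FImp B C) \<Longrightarrow>
    FO_nabla S \<Sigma> (add_mset (\<sigma>, B) \<Gamma>) (\<sigma>, C) \<Longrightarrow> FO_nabla S \<Sigma> \<Gamma> (\<sigma>, FImp B C)"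
| AllL: "wf_FO S \<Sigma> (add_mset (\<sigma>, FAll \<tau> B) \<Gamma>) J \<Longrightarrow>
    local_term S \<Sigma> \<sigma> t \<tau> \<Longrightarrow> inst_nf S \<sigma> B t B' \<Longrightarrow>
    FO_nabla S \<Sigma> (add_mset (\<sigma>, B') \<Gamma>) J \<Longrightarrow> FO_nabla S \<Sigma> (add_mset (\<sigma>, FAll \<tau> B) \<Gamma>) J"
| AllR: "wf_FO S \<Sigma> \<Gamma> (\<sigma>, FAll \<tau> B) \<Longrightarrow>
    h = (n, fns (rev \<sigma>) \<tau>) \<Longrightarrow> h \<notin> \<Sigma> \<Longrightarrow> inst_nf S \<sigma> B (apps (Var h) (local_vars \<sigma>)) B' \<Longrightarrow>
    FO_nabla S (insert h \<Sigma>) \<Gamma> (\<sigma>, B') \<Longrightarrow> FO_nabla S \<Sigma> \<Gamma> (\<sigma>, FAll \<tau> B)"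
| ExL: "wf_FO S \<Sigma> (add_mset (\<sigma>, FEx \<tau> B) \<Gamma>) J \<Longrightarrow>
    h = (n, fns (rev \<sigma>) \<tau>) \<Longrightarrow> h \<notin> \<Sigma> \<Longrightarrow> inst_nf S \<sigma> B (apps (Var h) (local_vars \<sigma>)) B' \<Longrightarrow>
    FO_nabla S (insert h \<Sigma>) (add_mset (\<sigma>, B') \<Gamma>) J \<Longrightarrow>
    FO_nabla S \<Sigma> (add_mset (\<sigma>, FEx \<tau> B) \<Gamma>) J"
| ExR: "wf_FO S \<Sigma> \<Gamma> (\<sigma>, FEx \<tau> B) \<Longrightarrow>
    local_term S \<Sigma> \<sigma> t \<tau> \<Longrightarrow> inst_nf S \<sigma> B t B' \<Longrightarrow>
    FO_nabla S \<Sigma> \<Gamma> (\<sigma>, B') \<Longrightarrow> FO_nabla S \<Sigma> \<Gamma> (\<sigma>, FEx \<tau> B)"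
| NabL: "wf_FO S \<Sigma> (add_mset (\<sigma>, FNab \<tau> B) \<Gamma>) J \<Longrightarrow>
    FO_nabla S \<Sigma> (add_mset (\<tau> # \<sigma>, B) \<Gamma>) J \<Longrightarrow> FO_nabla S \<Sigma> (add_mset (\<sigma>, FNab \<tau> B) \<Gamma>) J"
| NabR: "wf_FO S \<Sigma> \<Gamma> (\<sigma>, FNab \<tau> B) \<Longrightarrow>
    FO_nabla S \<Sigma> \<Gamma> (\<tau> # \<sigma>, B) \<Longrightarrow> FO_nabla S \<Sigma> \<Gamma> (\<sigma>, FNab \<tau> B)"

definition FO_nabla_provable :: "('b, 'k) lang \<Rightarrow> 'b name set \<Rightarrow> ('b, 'k) tm \<Rightarrow> bool" where
  "FO_nabla_provable S \<Sigma> F \<longleftrightarrow> FO_nabla S \<Sigma> {#} ([], F)"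

end

theory Submission
  imports Defs
begin

text \<open>A judgement \<open>\<sigma> \<triangleright> B\<close> corresponds to the LG formula obtained by replacing the variables of \<open>\<sigma>\<close>
  by distinct nominal constants; conversely, a formula with support in \<open>L\<close> is abstracted over \<open>L\<close>.
  The choice of \<open>L\<close> is immaterial: on the LG side by the rule \<open>id\<^sub>\<pi>\<close>, on the other side because the
  two axiom schemes, combined with the invertible \<open>\<nabla>\<close> rules, allow a local signature to be permuted,
  extended and shrunk. All rules then translate directly, except that the eigenvariables of
  \<open>FO\<lambda>\<nabla>\<close> are raised over all of \<open>\<sigma>\<close> and those of LG over the support only.\<close>

section \<open>Simultaneous substitution\<close>

text \<open>The mismatch in raising is one-sided. Coming from LG, the support of the quantified body
  can itself serve as the local signature, in the order in which the eigenvariable takes its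
  arguments, and then the two rules coincide.

  The second obstacle is syntactic. The quantifier rules ask for a beta-eta-long normal form of an
  instance, which is specified only up to \<open>conv\<close>. The normal forms constructed below
  come from putting neutral terms for leaves, which creates no redex, and from prefixing nabla
  quantifiers. When a rule of LG supplies another normal form of the same instance, it is exchanged
  for the constructed one by a derivation in the target logic.\<close>

primrec fb :: "('b, 'k) tm \<Rightarrow> nat set" where
  "fb (Bnd i) = {i}"
| "fb (Var x) = {}"
| "fb (Nom a) = {}"
| "fb (Con k) = {}"
| "fb (Log c) = {}"
| "fb (t \<cdot> u) = fb t \<union> fb u"
| "fb (Lam \<tau> t) = {i. Suc i \<in> fb t}"

text \<open>The arguments at which \<open>gsub\<close> consults its substitution, with indices
  counted from outside all binders.\<close>

definition leaves :: "('b, 'k) tm \<Rightarrow> ('b, 'k) tm set" where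
  "leaves t = Bnd ` fb t \<union> Var ` fv t \<union> Nom ` supp t"

definition up :: "(('b, 'k) tm \<Rightarrow> ('b, 'k) tm) \<Rightarrow> ('b, 'k) tm \<Rightarrow> ('b, 'k) tm" where
  "up \<theta> x = (case x of Bnd i \<Rightarrow> (case i of 0 \<Rightarrow> Bnd 0 | Suc j \<Rightarrow> ren Suc (\<theta> (Bnd j)))
     | _ \<Rightarrow> ren Suc (\<theta> x))"

text \<open>A substitution \<open>\<theta>\<close> is a function on terms of which only the values at the leaves \<open>Bnd i\<close>,
  \<open>Var x\<close> and \<open>Nom a\<close> matter; thus \<open>ren f\<close>, \<open>sub s\<close> and \<open>perm \<pi>\<close> can themselves be used as
  substitutions.\<close>

primrec gsub ::
  "(('b, 'k) tm \<Rightarrow> ('b, 'k) tm) \<Rightarrow> ('b, 'k) tm \<Rightarrow> ('b, 'k) tm" where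
  "gsub \<theta> (Bnd i) = \<theta> (Bnd i)"
| "gsub \<theta> (Var x) = \<theta> (Var x)"
| "gsub \<theta> (Nom a) = \<theta> (Nom a)"
| "gsub \<theta> (Con k) = Con k"
| "gsub \<theta> (Log c) = Log c"
| "gsub \<theta> (t \<cdot> u) = gsub \<theta> t \<cdot> gsub \<theta> u"
| "gsub \<theta> (Lam \<tau> t) = Lam \<tau> (gsub (up \<theta>) t)"

lemma up_simps [simp]:
  "up \<theta> (Bnd 0) = Bnd 0"
  "up \<theta> (Bnd (Suc i)) = ren Suc (\<theta> (Bnd i))"
  "up \<theta> (Var x) = ren Suc (\<theta> (Var x))"
  "up \<theta> (Nom a) = ren Suc (\<theta> (Nom a))"
  by (simp_all add: up_def)

lemma leaves_simps [simp]:
  "leaves (Bnd i) = {Bnd i}"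
  "leaves (Var x) = {Var x}"
  "leaves (Nom a) = {Nom a}"
  "leaves (t \<cdot> u) = leaves t \<union> leaves u"
  by (auto simp: leaves_def)

lemma leaves_cases:
  assumes "x \<in> leaves t"
  obtains i where "x = Bnd i" "i \<in> fb t" | y where "x = Var y" "y \<in> fv t"
    | a where "x = Nom a" "a \<in> supp t"
  using assms by (auto simp: leaves_def)

lemma gsub_cong: "(\<And>x. x \<in> leaves t \<Longrightarrow> \<theta> x = \<theta>' x) \<Longrightarrow> gsub \<theta> t = gsub \<theta>' t"
proof (induction t arbitrary: \<theta> \<theta>')
  case (App t u)
  then have "gsub \<theta> t = gsub \<theta>' t" "gsub \<theta> u = gsub \<theta>' u"
    by (metis Un_iff leaves_simps(4))+
  then show ?case by simp
next
  case (Lam \<tau> t)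
  have *: "y \<in> leaves (Lam \<tau> t) \<Longrightarrow> \<theta> y = \<theta>' y" for y
    using Lam.prems by blast
  have "up \<theta> x = up \<theta>' x" if "x \<in> leaves t" for x
    using that
  proof (cases rule: leaves_cases)
    case (1 i)
    then show ?thesis using *[of "Bnd (i - 1)"] by (cases i) (auto simp: leaves_def)
  next
    case (2 y)
    then show ?thesis using *[of "Var y"] by (auto simp: leaves_def)
  next
    case (3 a)
    then show ?thesis using *[of "Nom a"] by (auto simp: leaves_def)
  qed
  then have "gsub (up \<theta>) t = gsub (up \<theta>') t" by (rule Lam.IH)
  then show ?case by simp
qed auto

text \<open>Renaming, permuting and substituting are all brought under \<open>gsub\<close>, so that
  later identities between their compositions reduce to a check at the leaves by
  \<open>gsub_cong\<close>.\<close>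

lemma ren_as_gsub: "ren f t = gsub (ren f) t"
proof (induction t arbitrary: f)
  case (Lam \<tau> t)
  have "gsub (ren (case_nat 0 (\<lambda>i. Suc (f i)))) t = gsub (up (ren f)) t"
    by (rule gsub_cong) (auto simp: leaves_def split: nat.split)
  then show ?case by (metis Lam gsub.simps(7) ren.simps(7))
qed auto

lemma perm_as_gsub: "perm \<pi> t = gsub (perm \<pi>) t"
proof (induction t)
  case (Lam \<tau> t)
  have "gsub (perm \<pi>) t = gsub (up (perm \<pi>)) t"
    by (rule gsub_cong) (auto simp: leaves_def up_def split: nat.split)
  then show ?case using Lam by simp
qed auto

lemma gsub_id [simp]: "gsub (\<lambda>x. x) t = t"
proof (induction t)
  case (Lam \<tau> t)
  have "gsub (up (\<lambda>x. x)) t = gsub (\<lambda>x. x) t"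
    by (rule gsub_cong) (auto simp: leaves_def up_def split: nat.split)
  then show ?case using Lam by simp
qed auto

lemma gsub_ident: "(\<And>x. x \<in> leaves t \<Longrightarrow> \<theta> x = x) \<Longrightarrow> gsub \<theta> t = t"
  using gsub_cong[of t \<theta> "\<lambda>x. x"] by simp

lemma ren_ren [simp]: "ren f (ren g t) = ren (\<lambda>i. f (g i)) t"
proof (induction t arbitrary: f g)
  case (Lam \<tau> t)
  have "(\<lambda>i. case_nat 0 (\<lambda>i. Suc (f i)) (case_nat 0 (\<lambda>i. Suc (g i)) i)) =
     case_nat 0 (\<lambda>i. Suc (f (g i)))" by (auto split: nat.split)
  then show ?case by (simp add: Lam)
qed auto

lemma gsub_ren: "gsub \<theta> (ren f t) = gsub (\<lambda>x. \<theta> (ren f x)) t"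
proof (induction t arbitrary: f \<theta>)
  case (Lam \<tau> t)
  have "gsub (\<lambda>x. up \<theta> (ren (case_nat 0 (\<lambda>i. Suc (f i))) x)) t = gsub (up (\<lambda>x. \<theta> (ren f x))) t"
    by (rule gsub_cong) (auto simp: leaves_def up_def split: nat.split)
  then show ?case by (simp add: Lam)
qed auto

lemma ren_gsub: "ren f (gsub \<theta> t) = gsub (\<lambda>x. ren f (\<theta> x)) t"
proof (induction t arbitrary: f \<theta>)
  case (Lam \<tau> t)
  have "gsub (\<lambda>x. ren (case_nat 0 (\<lambda>i. Suc (f i))) (up \<theta> x)) t = gsub (up (\<lambda>x. ren f (\<theta> x))) t"
    by (rule gsub_cong) (auto simp: leaves_def up_def split: nat.split)
  then show ?case by (simp add: Lam)
qed auto

text \<open>The lifted substitution meets only shifted leaves here, never the new index 0. This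
  carries both composition under a binder and the eta rule.\<close>

lemma gsub_up_ren_Suc: "gsub (up \<theta>) (ren Suc t) = ren Suc (gsub \<theta> t)"
  unfolding gsub_ren ren_gsub by (rule gsub_cong) (auto simp: leaves_def)

lemma gsub_gsub: "gsub \<theta> (gsub \<theta>' t) = gsub (\<lambda>x. gsub \<theta> (\<theta>' x)) t"
proof (induction t arbitrary: \<theta> \<theta>')
  case (Lam \<tau> t)
  have "gsub (\<lambda>x. gsub (up \<theta>) (up \<theta>' x)) t = gsub (up (\<lambda>x. gsub \<theta> (\<theta>' x))) t"
    by (rule gsub_cong) (auto simp: leaves_def up_def gsub_up_ren_Suc split: nat.split)
  then show ?case by (simp add: Lam)
qed auto

lemma sub_as_gsub: "sub s t = gsub (sub s) t"
proof (induction t arbitrary: s)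
  case (Lam \<tau> t)
  have "gsub (sub (case_nat (Bnd 0) (\<lambda>i. ren Suc (s i)))) t = gsub (up (sub s)) t"
    by (rule gsub_cong) (auto simp: leaves_def up_def split: nat.split)
  then show ?case by (metis Lam gsub.simps(7) sub.simps(7))
qed auto

lemma inst_as_gsub: "inst B t = gsub (sub (case_nat t Bnd)) B"
  unfolding inst_def by (rule sub_as_gsub)

lemma inst_ren_Suc [simp]: "inst (ren Suc B) t = B"
  unfolding inst_as_gsub gsub_ren by (rule gsub_ident) (auto simp: leaves_def)

text \<open>The substitution lemma. Both sides fuse into one substitution, and at the leaves beyond
  the binder the instantiation cancels the shift made by \<open>up\<close>.\<close>

lemma gsub_inst: "gsub \<theta> (inst B t) = inst (gsub (up \<theta>) B) (gsub \<theta> t)"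
  unfolding inst_as_gsub gsub_gsub
proof (rule gsub_cong)
  fix x assume "x \<in> leaves B"
  have *: "gsub (sub (case_nat (gsub \<theta> t) Bnd)) (ren Suc u) = u" for u
    using inst_ren_Suc[of u] by (simp add: inst_as_gsub)
  from \<open>x \<in> leaves B\<close>
  show "gsub \<theta> (sub (case_nat t Bnd) x) = gsub (sub (case_nat (gsub \<theta> t) Bnd)) (up \<theta> x)"
    by (auto simp: leaves_def * up_def split: nat.split)
qed

section \<open>Free variables and support under substitution\<close>

lemma fv_ren [simp]: "fv (ren f t) = fv t"
  by (induction t arbitrary: f) auto

lemma supp_ren [simp]: "supp (ren f t) = supp t"
  by (induction t arbitrary: f) auto

text \<open>The images met under a binder are the bound variable or shifts of images met outside it,
  which bounds \<open>fv\<close> and \<open>supp\<close> in the abstraction case.\<close>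

lemma leaves_up:
  assumes "x \<in> leaves t"
  shows "up \<theta> x = Bnd 0 \<or> (\<exists>y \<in> leaves (Lam \<tau> t). up \<theta> x = ren Suc (\<theta> y))"
  using assms
proof (cases rule: leaves_cases)
  case (1 i)
  then show ?thesis by (cases i) (auto simp: leaves_def)
qed (auto simp: leaves_def)

lemma fv_gsub: "fv (gsub \<theta> t) \<subseteq> (\<Union>x \<in> leaves t. fv (\<theta> x))"
proof (induction t arbitrary: \<theta>)
  case (App t u)
  show ?case using App.IH(1)[of \<theta>] App.IH(2)[of \<theta>] by auto
next
  case (Lam \<tau> t)
  have "fv (up \<theta> x) \<subseteq> (\<Union>x \<in> leaves (Lam \<tau> t). fv (\<theta> x))" if "x \<in> leaves t" for x
    using leaves_up[OF that, of \<theta> \<tau>] by auto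
  then show ?case using Lam[of "up \<theta>"] by fastforce
qed auto

lemma supp_gsub: "supp (gsub \<theta> t) \<subseteq> (\<Union>x \<in> leaves t. supp (\<theta> x))"
proof (induction t arbitrary: \<theta>)
  case (App t u)
  show ?case using App.IH(1)[of \<theta>] App.IH(2)[of \<theta>] by auto
next
  case (Lam \<tau> t)
  have "supp (up \<theta> x) \<subseteq> (\<Union>x \<in> leaves (Lam \<tau> t). supp (\<theta> x))" if "x \<in> leaves t" for x
    using leaves_up[OF that, of \<theta> \<tau>] by auto
  then show ?case using Lam[of "up \<theta>"] by fastforce
qed auto

lemma finite_supp [simp]: "finite (supp t)"
  by (induction t) auto

section \<open>Conversion and typing under substitution\<close>

text \<open>The beta case is \<open>gsub_inst\<close>, the eta case is
  \<open>gsub_up_ren_Suc\<close>.\<close>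

lemma conv_gsub: "conv t u \<Longrightarrow> conv (gsub \<theta> t) (gsub \<theta> u)"
proof (induction arbitrary: \<theta> rule: conv.induct)
  case (beta \<tau> t u)
  show ?case using conv.beta by (simp add: gsub_inst)
next
  case (eta \<tau> t)
  show ?case using conv.eta by (simp add: gsub_up_ren_Suc)
next
  case (trans t u v)
  then show ?case using conv.trans by blast
qed (auto intro: conv.app conv.lam conv.refl conv.sym)

lemma conv_ren: "conv t u \<Longrightarrow> conv (ren f t) (ren f u)"
  using conv_gsub[of t u "ren f"] by (simp flip: ren_as_gsub)

lemma conv_gsub_pointwise:
  "(\<And>x. x \<in> leaves t \<Longrightarrow> conv (\<theta> x) (\<theta>' x)) \<Longrightarrow> conv (gsub \<theta> t) (gsub \<theta>' t)"
proof (induction t arbitrary: \<theta> \<theta>')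
  case (Lam \<tau> t)
  have *: "y \<in> leaves (Lam \<tau> t) \<Longrightarrow> conv (ren Suc (\<theta> y)) (ren Suc (\<theta>' y))" for y
    using Lam.prems conv_ren by blast
  have "conv (up \<theta> x) (up \<theta>' x)" if "x \<in> leaves t" for x
    using that
  proof (cases rule: leaves_cases)
    case (1 i)
    then show ?thesis using *[of "Bnd (i - 1)"] by (cases i) (auto simp: leaves_def intro: conv.refl)
  next
    case (2 y)
    then show ?thesis using *[of "Var y"] by (auto simp: leaves_def)
  next
    case (3 a)
    then show ?thesis using *[of "Nom a"] by (auto simp: leaves_def)
  qed
  then have "conv (gsub (up \<theta>) t) (gsub (up \<theta>') t)" by (rule Lam.IH)
  then show ?case by (simp add: conv.lam)
qed (auto intro: conv.app conv.lam conv.refl)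

lemma conv_inst: "conv t u \<Longrightarrow> conv (inst B t) (inst B u)"
  unfolding inst_as_gsub
  by (rule conv_gsub_pointwise) (auto simp: leaves_def intro: conv.refl split: nat.split)

lemma conv_apps:
  "conv t t' \<Longrightarrow> list_all2 conv us us' \<Longrightarrow> conv (apps t us) (apps t' us')"
  unfolding apps_def
  by (rotate_tac, induction us us' arbitrary: t t' rule: list_all2_induct) (auto intro: conv.app)

lemma apps_simps [simp]: "apps t [] = t" "apps t (u # us) = apps (t \<cdot> u) us"
  "apps t (us @ vs) = apps (apps t us) vs"
  by (simp_all add: apps_def)

lemma gsub_apps: "gsub \<theta> (apps t us) = apps (gsub \<theta> t) (map (gsub \<theta>) us)"
  by (induction us arbitrary: t) auto

lemma fv_apps: "fv (apps t us) = fv t \<union> (\<Union>u \<in> set us. fv u)"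
  by (induction us arbitrary: t) auto

lemma supp_apps: "supp (apps t us) = supp t \<union> (\<Union>u \<in> set us. supp u)"
  by (induction us arbitrary: t) auto

lemma neutral_leaf:
  "snd x = \<tau> \<Longrightarrow> neutral S \<Delta> (Var x) \<tau>"
  "snd a = \<tau> \<Longrightarrow> \<tau> \<in> nominal S \<Longrightarrow> neutral S \<Delta> (Nom a) \<tau>"
  "i < length \<Delta> \<Longrightarrow> \<Delta> ! i = \<tau> \<Longrightarrow> neutral S \<Delta> (Bnd i) \<tau>"
  by (auto intro: long_nf_neutral.intros)

lemma long_nf_ren:
  "long_nf S \<Delta> t \<tau> \<Longrightarrow> (\<And>i. i < length \<Delta> \<Longrightarrow> f i < length \<Delta>' \<and> \<Delta>' ! f i = \<Delta> ! i) \<Longrightarrow>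
     long_nf S \<Delta>' (ren f t) \<tau>"
  "neutral S \<Delta> t \<tau> \<Longrightarrow> (\<And>i. i < length \<Delta> \<Longrightarrow> f i < length \<Delta>' \<and> \<Delta>' ! f i = \<Delta> ! i) \<Longrightarrow>
     neutral S \<Delta>' (ren f t) \<tau>"
proof (induction arbitrary: f \<Delta>' and f \<Delta>' rule: long_nf_neutral.inducts)
  case (1 \<tau> \<Delta> t \<rho>)
  show ?case using 1 by (auto intro!: long_nf_neutral.intros 1(2) split: nat.split)
next
  case (4 i \<Delta>)
  then show ?case using long_nf_neutral.intros(4)[of "f i" \<Delta>'] by (metis ren.simps(1))
next
  case (9 \<Delta> t \<tau> \<rho> u)
  show ?case using 9(2,4)[OF 9(5)] by (auto intro: long_nf_neutral.intros(9))
qed (auto intro: long_nf_neutral.intros)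

text \<open>The images are required to be neutral: putting a neutral term for a head creates no
  redex and keeps the type, so long normal forms are preserved as they stand.\<close>

definition wt_subst ::
  "('b, 'k) lang \<Rightarrow> 'b ty list \<Rightarrow> 'b ty list \<Rightarrow> (('b, 'k) tm \<Rightarrow> ('b, 'k) tm) \<Rightarrow> bool" where
  "wt_subst S \<Delta> \<Delta>' \<theta> \<longleftrightarrow> (\<forall>i < length \<Delta>. neutral S \<Delta>' (\<theta> (Bnd i)) (\<Delta> ! i)) \<and>
     (\<forall>x. neutral S \<Delta>' (\<theta> (Var x)) (snd x)) \<and>
     (\<forall>a. snd a \<in> nominal S \<longrightarrow> neutral S \<Delta>' (\<theta> (Nom a)) (snd a))"

lemma wt_subst_up: "wt_subst S \<Delta> \<Delta>' \<theta> \<Longrightarrow> wt_subst S (\<tau> # \<Delta>) (\<tau> # \<Delta>') (up \<theta>)"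
proof -
  assume *: "wt_subst S \<Delta> \<Delta>' \<theta>"
  have "neutral S (\<tau> # \<Delta>') (Bnd 0) \<tau>"
    using long_nf_neutral.intros(4)[of 0 "\<tau> # \<Delta>'"] by simp
  then show ?thesis using *
    unfolding wt_subst_def
    by (auto simp: less_Suc_eq_0_disj intro!: long_nf_ren(2)[where \<Delta> = \<Delta>'])
qed

lemma long_nf_gsub:
  "long_nf S \<Delta> t \<tau> \<Longrightarrow> wt_subst S \<Delta> \<Delta>' \<theta> \<Longrightarrow> long_nf S \<Delta>' (gsub \<theta> t) \<tau>"
  "neutral S \<Delta> t \<tau> \<Longrightarrow> wt_subst S \<Delta> \<Delta>' \<theta> \<Longrightarrow> neutral S \<Delta>' (gsub \<theta> t) \<tau>"
proof (induction arbitrary: \<theta> \<Delta>' and \<theta> \<Delta>' rule: long_nf_neutral.inducts)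
  case (1 \<tau> \<Delta> t \<rho>)
  then show ?case by (auto intro!: long_nf_neutral.intros wt_subst_up)
next
  case (9 \<Delta> t \<tau> \<rho> u)
  then show ?case by (auto intro!: long_nf_neutral.intros(9))
qed (auto simp: wt_subst_def intro: long_nf_neutral.intros)

lemma typed_ren:
  "typed S \<Delta> t \<tau> \<Longrightarrow> (\<And>i. i < length \<Delta> \<Longrightarrow> f i < length \<Delta>' \<and> \<Delta>' ! f i = \<Delta> ! i) \<Longrightarrow>
     typed S \<Delta>' (ren f t) \<tau>"
proof (induction arbitrary: f \<Delta>' rule: typed.induct)
  case (1 i \<Delta>)
  then show ?case using typed.intros(1)[of "f i" \<Delta>'] by (metis ren.simps(1))
next
  case (6 \<Delta> t \<tau> \<rho> u)
  show ?case using "6.IH"[OF "6.prems"] by (auto intro: typed.intros(6))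
next
  case (7 \<tau> \<Delta> t \<rho>)
  show ?case by (auto intro!: typed.intros 7 dest: 7(3) split: nat.split)
qed (auto intro: typed.intros)

definition typed_subst ::
  "('b, 'k) lang \<Rightarrow> 'b ty list \<Rightarrow> 'b ty list \<Rightarrow> (('b, 'k) tm \<Rightarrow> ('b, 'k) tm) \<Rightarrow> bool" where
  "typed_subst S \<Delta> \<Delta>' \<theta> \<longleftrightarrow> (\<forall>i < length \<Delta>. typed S \<Delta>' (\<theta> (Bnd i)) (\<Delta> ! i)) \<and>
     (\<forall>x. typed S \<Delta>' (\<theta> (Var x)) (snd x)) \<and>
     (\<forall>a. snd a \<in> nominal S \<longrightarrow> typed S \<Delta>' (\<theta> (Nom a)) (snd a))"

lemma typed_subst_up: "typed_subst S \<Delta> \<Delta>' \<theta> \<Longrightarrow> typed_subst S (\<tau> # \<Delta>) (\<tau> # \<Delta>') (up \<theta>)"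
proof -
  assume *: "typed_subst S \<Delta> \<Delta>' \<theta>"
  have "typed S (\<tau> # \<Delta>') (Bnd 0) \<tau>"
    using typed.intros(1)[of 0 "\<tau> # \<Delta>'"] by simp
  then show ?thesis using *
    unfolding typed_subst_def
    by (auto simp: less_Suc_eq_0_disj intro!: typed_ren[where \<Delta> = \<Delta>'])
qed

lemma typed_gsub:
  "typed S \<Delta> t \<tau> \<Longrightarrow> typed_subst S \<Delta> \<Delta>' \<theta> \<Longrightarrow> typed S \<Delta>' (gsub \<theta> t) \<tau>"
proof (induction arbitrary: \<theta> \<Delta>' rule: typed.induct)
  case (6 \<Delta> t \<tau> \<rho> u)
  then show ?case by (auto intro!: typed.intros(6))
next
  case (7 \<tau> \<Delta> t \<rho>)
  then show ?case by (auto intro!: typed.intros typed_subst_up)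
qed (auto simp: typed_subst_def intro: typed.intros)

lemma nf_typed:
  "long_nf S \<Delta> t \<tau> \<Longrightarrow> typed S \<Delta> t \<tau>" "neutral S \<Delta> t \<tau> \<Longrightarrow> typed S \<Delta> t \<tau>"
  by (induction rule: long_nf_neutral.inducts) (auto intro: typed.intros)

lemma wt_subst_typed: "wt_subst S \<Delta> \<Delta>' \<theta> \<Longrightarrow> typed_subst S \<Delta> \<Delta>' \<theta>"
  by (auto simp: wt_subst_def typed_subst_def intro: nf_typed)

lemma typed_fb: "typed S \<Delta> t \<tau> \<Longrightarrow> fb t \<subseteq> {..<length \<Delta>}"
  by (induction rule: typed.induct) auto

lemma typed_supp: "typed S \<Delta> t \<tau> \<Longrightarrow> snd ` supp t \<subseteq> nominal S"
  by (induction rule: typed.induct) auto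

section \<open>Inversion of long normal formulas\<close>

inductive_cases neutral_AppE: "neutral S \<Delta> (t \<cdot> u) \<rho>"
inductive_cases neutral_LogE: "neutral S \<Delta> (Log c) \<rho>"
inductive_cases long_nf_PropE: "long_nf S \<Delta> t Prop"
inductive_cases long_nf_FnE: "long_nf S \<Delta> t (\<tau> \<rightarrow> \<rho>)"

text \<open>At type \<open>Prop\<close> a long normal form is neutral, so inversion peels the
  arguments off the logical constant.\<close>

lemma long_nf_binary:
  assumes "logical_ty c = Prop \<rightarrow> Prop \<rightarrow> Prop" and "logical_ok S c"
  shows "long_nf S \<Delta> (Log c \<cdot> B \<cdot> C) Prop \<longleftrightarrow> long_nf S \<Delta> B Prop \<and> long_nf S \<Delta> C Prop"
proof
  assume "long_nf S \<Delta> (Log c \<cdot> B \<cdot> C) Prop"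
  then show "long_nf S \<Delta> B Prop \<and> long_nf S \<Delta> C Prop" using assms
    by (auto elim!: long_nf_PropE neutral_AppE neutral_LogE)
next
  assume *: "long_nf S \<Delta> B Prop \<and> long_nf S \<Delta> C Prop"
  have "neutral S \<Delta> (Log c) (Prop \<rightarrow> Prop \<rightarrow> Prop)"
    using long_nf_neutral.intros(8)[OF assms(2), of \<Delta>] assms(1) by simp
  then show "long_nf S \<Delta> (Log c \<cdot> B \<cdot> C) Prop" using *
    by (auto intro: long_nf_neutral.intros)
qed

lemma long_nf_quantifier:
  assumes "logical_ty c = (\<tau> \<rightarrow> Prop) \<rightarrow> Prop"
  shows "long_nf S \<Delta> (Log c \<cdot> Lam \<tau> B) Prop \<longleftrightarrow> logical_ok S c \<and> long_nf S (\<tau> # \<Delta>) B Prop"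
proof
  assume "long_nf S \<Delta> (Log c \<cdot> Lam \<tau> B) Prop"
  then show "logical_ok S c \<and> long_nf S (\<tau> # \<Delta>) B Prop" using assms
    by (auto elim!: neutral_AppE neutral_LogE long_nf_FnE elim: long_nf_PropE)
next
  assume *: "logical_ok S c \<and> long_nf S (\<tau> # \<Delta>) B Prop"
  have "neutral S \<Delta> (Log c) ((\<tau> \<rightarrow> Prop) \<rightarrow> Prop)"
    using long_nf_neutral.intros(8)[of S c \<Delta>] assms(1) * by simp
  then show "long_nf S \<Delta> (Log c \<cdot> Lam \<tau> B) Prop" using *
    by (auto intro: long_nf_neutral.intros)
qed

lemma long_nf_formula [simp]:
  "long_nf S \<Delta> (FAnd B C) Prop \<longleftrightarrow> long_nf S \<Delta> B Prop \<and> long_nf S \<Delta> C Prop"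
  "long_nf S \<Delta> (FOr B C) Prop \<longleftrightarrow> long_nf S \<Delta> B Prop \<and> long_nf S \<Delta> C Prop"
  "long_nf S \<Delta> (FImp B C) Prop \<longleftrightarrow> long_nf S \<Delta> B Prop \<and> long_nf S \<Delta> C Prop"
  "long_nf S \<Delta> (FAll \<tau> D) Prop \<longleftrightarrow> prop_free \<tau> \<and> long_nf S (\<tau> # \<Delta>) D Prop"
  "long_nf S \<Delta> (FEx \<tau> D) Prop \<longleftrightarrow> prop_free \<tau> \<and> long_nf S (\<tau> # \<Delta>) D Prop"
  "long_nf S \<Delta> (FNab \<tau> D) Prop \<longleftrightarrow> \<tau> \<in> nominal S \<and> long_nf S (\<tau> # \<Delta>) D Prop"
  by (simp_all add: long_nf_binary long_nf_quantifier)

text \<open>A nominal type may be a function type, so a nominal constant passed as an argument is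
  long normal only after expansion.\<close>

primrec eta_exp :: "'b ty \<Rightarrow> ('b, 'k) tm \<Rightarrow> ('b, 'k) tm" where
  "eta_exp Prop = (\<lambda>t. t)"
| "eta_exp (Base b) = (\<lambda>t. t)"
| "eta_exp (\<tau> \<rightarrow> \<rho>) = (\<lambda>t. Lam \<tau> (eta_exp \<rho> (ren Suc t \<cdot> eta_exp \<tau> (Bnd 0))))"

lemma long_nf_eta_exp: "neutral S \<Delta> t \<tau> \<Longrightarrow> long_nf S \<Delta> (eta_exp \<tau> t) \<tau>"
proof (induction \<tau> arbitrary: \<Delta> t)
  case (Fn \<tau> \<rho>)
  have "long_nf S (\<tau> # \<Delta>) (eta_exp \<tau> (Bnd 0)) \<tau>"
    using Fn.IH(1)[of "\<tau> # \<Delta>" "Bnd 0"] long_nf_neutral.intros(4)[of 0 "\<tau> # \<Delta>" S] by simp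
  moreover have "neutral S (\<tau> # \<Delta>) (ren Suc t) (\<tau> \<rightarrow> \<rho>)"
    by (rule long_nf_ren(2)[OF Fn.prems]) auto
  ultimately show ?case by (auto intro!: long_nf_neutral.intros(1) Fn.IH(2) intro: long_nf_neutral.intros(9))
qed (auto intro: long_nf_neutral.intros)

lemma conv_eta_exp: "conv (eta_exp \<tau> t) t"
proof (induction \<tau> arbitrary: t)
  case (Fn \<tau> \<rho>)
  have "conv (eta_exp \<rho> (ren Suc t \<cdot> eta_exp \<tau> (Bnd 0))) (ren Suc t \<cdot> Bnd 0)"
    using Fn.IH(2) conv.app[OF conv.refl Fn.IH(1)] conv.trans by blast
  then show ?case using conv.eta conv.lam conv.trans by (metis eta_exp.simps(3))
qed (auto intro: conv.refl)

lemma fv_eta_exp [simp]: "fv (eta_exp \<tau> t) = fv t"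
  by (induction \<tau> arbitrary: t) auto

lemma supp_eta_exp [simp]: "supp (eta_exp \<tau> t) = supp t"
  by (induction \<tau> arbitrary: t) auto

lemma fns_simps [simp]: "fns [] \<rho> = \<rho>" "fns (\<tau> # \<tau>s) \<rho> = \<tau> \<rightarrow> fns \<tau>s \<rho>"
  "fns (\<tau>s @ \<rho>s) \<rho> = fns \<tau>s (fns \<rho>s \<rho>)"
  by (simp_all add: fns_def)

lemma prop_free_fns: "prop_free (fns \<tau>s \<rho>) \<longleftrightarrow> (\<forall>\<tau> \<in> set \<tau>s. prop_free \<tau>) \<and> prop_free \<rho>"
  by (induction \<tau>s) auto

lemma neutral_apps:
  "list_all2 (long_nf S \<Delta>) us \<tau>s \<Longrightarrow> neutral S \<Delta> t (fns \<tau>s \<rho>) \<Longrightarrow> neutral S \<Delta> (apps t us) \<rho>"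
  by (induction us \<tau>s arbitrary: t rule: list_all2_induct) (auto intro: long_nf_neutral.intros)

lemma typed_apps:
  "list_all2 (typed S \<Delta>) us \<tau>s \<Longrightarrow> typed S \<Delta> t (fns \<tau>s \<rho>) \<Longrightarrow> typed S \<Delta> (apps t us) \<rho>"
  by (induction us \<tau>s arbitrary: t rule: list_all2_induct) (auto intro: typed.intros)

lemma inst_fv: "fv (inst B t) \<subseteq> fv B \<union> fv t" and inst_supp: "supp (inst B t) \<subseteq> supp B \<union> supp t"
  unfolding inst_as_gsub
  by (rule order_trans[OF fv_gsub] order_trans[OF supp_gsub];
      auto simp: leaves_def split: nat.splits)+

lemma long_nf_inst:
  assumes "long_nf S (\<tau> # \<Delta>) B Prop" "neutral S \<Delta> t \<tau>"
  shows "long_nf S \<Delta> (inst B t) Prop"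
  unfolding inst_as_gsub
  by (rule long_nf_gsub(1)[OF assms(1)])
    (auto simp: wt_subst_def less_Suc_eq_0_disj assms(2) intro: neutral_leaf)

section \<open>Abstracting and instantiating nominal constants\<close>

primrec idx :: "'a list \<Rightarrow> 'a \<Rightarrow> nat" where
  "idx [] a = 0"
| "idx (b # L) a = (if a = b then 0 else Suc (idx L a))"

lemma idx_less [simp]: "a \<in> set L \<Longrightarrow> idx L a < length L"
  by (induction L) auto

lemma nth_idx [simp]: "a \<in> set L \<Longrightarrow> L ! idx L a = a"
  by (induction L) auto

lemma idx_nth [simp]: "distinct L \<Longrightarrow> i < length L \<Longrightarrow> idx L (L ! i) = i"
  by (induction L arbitrary: i) (auto simp: less_Suc_eq_0_disj)

text \<open>Loose indices move up by \<open>length L\<close> to make room; the indices below then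
  stand for the constants \<open>L ! i\<close>.\<close>

definition abs_leaf :: "'b name list \<Rightarrow> ('b, 'k) tm \<Rightarrow> ('b, 'k) tm" where
  "abs_leaf L x = (case x of Bnd i \<Rightarrow> Bnd (i + length L)
     | Nom a \<Rightarrow> if a \<in> set L then Bnd (idx L a) else Nom a | _ \<Rightarrow> x)"

definition abs_noms :: "'b name list \<Rightarrow> ('b, 'k) tm \<Rightarrow> ('b, 'k) tm" where
  "abs_noms L = gsub (abs_leaf L)"

text \<open>The effect of contracting \<open>length us\<close> nested abstractions at once: the
  first indices receive \<open>us\<close>, the others drop.\<close>

definition args_leaf :: "('b, 'k) tm list \<Rightarrow> ('b, 'k) tm \<Rightarrow> ('b, 'k) tm" where
  "args_leaf us x = (case x of
     Bnd i \<Rightarrow> if i < length us then us ! i else Bnd (i - length us) | _ \<Rightarrow> x)"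

definition ins_noms :: "'b name list \<Rightarrow> ('b, 'k) tm \<Rightarrow> ('b, 'k) tm" where
  "ins_noms L = gsub (args_leaf (map Nom L))"

lemma leaf_simps [simp]:
  "abs_leaf L (Bnd i) = Bnd (i + length L)"
  "abs_leaf L (Nom a) = (if a \<in> set L then Bnd (idx L a) else Nom a)"
  "abs_leaf L (Var x) = Var x"
  "args_leaf us (Bnd i) = (if i < length us then us ! i else Bnd (i - length us))"
  "args_leaf us (Nom a) = Nom a"
  "args_leaf us (Var x) = Var x"
  by (simp_all add: abs_leaf_def args_leaf_def)

lemma noms_simps [simp]:
  "abs_noms L (Log c) = Log c"
  "abs_noms L (t \<cdot> u) = abs_noms L t \<cdot> abs_noms L u"
  "abs_noms L (Lam \<tau> t) = Lam \<tau> (gsub (up (abs_leaf L)) t)"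
  "ins_noms L (Log c) = Log c"
  "ins_noms L (t \<cdot> u) = ins_noms L t \<cdot> ins_noms L u"
  "ins_noms L (Lam \<tau> t) = Lam \<tau> (gsub (up (args_leaf (map Nom L))) t)"
  by (simp_all add: abs_noms_def ins_noms_def)

lemma ins_abs_noms [simp]: "ins_noms L (abs_noms L t) = t"
  unfolding ins_noms_def abs_noms_def gsub_gsub
  by (rule gsub_ident) (auto simp: leaves_def)

text \<open>A constant of \<open>L\<close> already present in \<open>t\<close> would be captured by
  the abstraction, and a repeated constant would merge two indices; the hypotheses exclude
  both.\<close>

lemma abs_ins_noms:
  assumes "distinct L" and "supp t \<inter> set L = {}"
  shows "abs_noms L (ins_noms L t) = t"
  unfolding ins_noms_def abs_noms_def gsub_gsub
  by (rule gsub_ident) (use assms in \<open>auto simp: leaves_def\<close>)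

lemma abs_ins_noms_body:
  assumes "distinct L" and "supp t \<inter> set L = {}"
  shows "gsub (up (abs_leaf L)) (gsub (up (args_leaf (map Nom L))) t) = t"
  \<comment> \<open>Wrapping the body in an abstraction reduces the lifted identity to the unlifted
    one; the type \<open>Prop\<close> of the binder is arbitrary.\<close>
  using abs_ins_noms[OF assms(1), of "Lam Prop t"] assms(2) by simp

text \<open>The lifted arguments are shifted past the binder and \<open>inst\<close> undoes that
  shift, so the bound variable becomes the first index of one simultaneous instantiation.\<close>

lemma inst_args: "inst (gsub (up (args_leaf us)) t) u = gsub (args_leaf (u # us)) t"
  unfolding inst_as_gsub gsub_gsub
proof (rule gsub_cong)
  fix x assume "x \<in> leaves t"
  moreover have "gsub (sub (case_nat u Bnd)) (ren Suc v) = v" for v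
    using inst_ren_Suc[of v u] by (simp only: inst_as_gsub)
  ultimately show "gsub (sub (case_nat u Bnd)) (up (args_leaf us) x) = args_leaf (u # us) x"
    by (auto simp: leaves_def up_def split: nat.split)
qed

lemma ins_noms_Cons: "ins_noms (a # L) t = inst (gsub (up (args_leaf (map Nom L))) t) (Nom a)"
  by (simp add: ins_noms_def inst_args)

lemma ins_noms_Nil [simp]: "ins_noms [] t = t" and abs_noms_Nil [simp]: "abs_noms [] t = t"
  unfolding ins_noms_def abs_noms_def
  by (rule gsub_ident; auto simp: leaves_def)+

text \<open>The head of the list becomes index 0, the most recent local variable. Abstracting it
  alone yields the body of a binder, and the tail is abstracted around that binder.\<close>

lemma abs_noms_Cons: "abs_noms (a # L) t = gsub (up (abs_leaf L)) (abs_noms [a] t)"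
  unfolding abs_noms_def gsub_gsub by (rule gsub_cong) (auto simp: leaves_def)

lemma abs_noms_Cons_vacuous: "a \<notin> supp t \<Longrightarrow> abs_noms (a # L) t = ren Suc (abs_noms L t)"
  unfolding abs_noms_def ren_gsub by (rule gsub_cong) (auto simp: leaves_def)

lemma abs_noms_swap:
  "a \<noteq> b \<Longrightarrow> ren (id(0 := 1, 1 := 0)) (abs_noms (a # b # L) t) = abs_noms (b # a # L) t"
  unfolding abs_noms_def ren_gsub by (rule gsub_cong) (auto simp: leaves_def)

text \<open>A fresh constant put for the bound variable and abstracted again returns that variable.
  Hence the premise of a nabla rule of LG turns into the premise of the local-signature
  rule.\<close>

lemma abs_noms_inst: "a \<notin> supp B \<Longrightarrow> abs_noms (a # L) (inst B (Nom a)) = gsub (up (abs_leaf L)) B"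
proof -
  assume "a \<notin> supp B"
  then have "abs_noms [a] (inst B (Nom a)) = B"
    unfolding abs_noms_def inst_as_gsub gsub_gsub
    by (intro gsub_ident) (auto simp: leaves_def split: nat.split)
  then show ?thesis using abs_noms_Cons[of a L "inst B (Nom a)"] by simp
qed

lemma wt_subst_abs_leaf: "wt_subst S [] (map snd L) (abs_leaf L)"
  by (auto simp: wt_subst_def intro!: neutral_leaf)

lemma wt_subst_ins: "snd ` set L \<subseteq> nominal S \<Longrightarrow> wt_subst S (map snd L) [] (args_leaf (map Nom L))"
  by (auto simp: wt_subst_def intro!: neutral_leaf)

lemma fv_abs_noms: "fv (abs_noms L t) \<subseteq> fv t"
  unfolding abs_noms_def by (rule order_trans[OF fv_gsub]) (auto simp: leaves_def split: if_splits)

lemma supp_abs_noms: "supp (abs_noms L t) \<subseteq> supp t - set L"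
  unfolding abs_noms_def by (rule order_trans[OF supp_gsub]) (auto simp: leaves_def split: if_splits)

lemma fv_ins_noms: "fv (ins_noms L t) \<subseteq> fv t"
  unfolding ins_noms_def by (rule order_trans[OF fv_gsub]) (auto simp: leaves_def split: if_splits)

lemma supp_ins_noms: "supp (ins_noms L t) \<subseteq> supp t \<union> set L"
  unfolding ins_noms_def by (rule order_trans[OF supp_gsub]) (auto simp: leaves_def split: if_splits)

lemma wf_judgment_abs_noms:
  assumes "formula S \<Sigma> F" "supp F \<subseteq> set L" "snd ` set L \<subseteq> nominal S"
  shows "wf_judgment S \<Sigma> (map snd L, abs_noms L F)"
  using assms long_nf_gsub(1)[OF _ wt_subst_abs_leaf] fv_abs_noms[of L F] supp_abs_noms[of L F]
  by (auto simp: formula_def abs_noms_def)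

lemma formula_ins_noms:
  assumes "wf_judgment S \<Sigma> (map snd L, B)"
  shows "formula S \<Sigma> (ins_noms L B)"
  using assms long_nf_gsub(1)[OF _ wt_subst_ins] fv_ins_noms[of L B]
  by (auto simp: formula_def ins_noms_def)

section \<open>Closing a judgement by nabla or by abstraction\<close>

primrec nabs :: "'b ty list \<Rightarrow> ('b, 'k) tm \<Rightarrow> ('b, 'k) tm" where
  "nabs [] B = B"
| "nabs (\<tau> # \<sigma>) B = nabs \<sigma> (FNab \<tau> B)"

primrec lams :: "'b ty list \<Rightarrow> ('b, 'k) tm \<Rightarrow> ('b, 'k) tm" where
  "lams [] t = t"
| "lams (\<tau> # \<sigma>) t = lams \<sigma> (Lam \<tau> t)"

lemma wf_judgment_FNab: "wf_judgment S \<Sigma> (\<sigma>, FNab \<tau> B) \<longleftrightarrow> wf_judgment S \<Sigma> (\<tau> # \<sigma>, B)"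
  by auto

lemma wf_judgment_nabs: "wf_judgment S \<Sigma> (\<sigma>, B) \<longleftrightarrow> wf_judgment S \<Sigma> ([], nabs \<sigma> B)"
proof (induction \<sigma> arbitrary: B)
  case (Cons \<tau> \<sigma>)
  show ?case using Cons[of "FNab \<tau> B"] by (simp only: wf_judgment_FNab nabs.simps)
qed simp

lemma conv_nabs: "conv B B' \<Longrightarrow> conv (nabs \<sigma> B) (nabs \<sigma> B')"
  by (induction \<sigma> arbitrary: B B') (auto intro: conv.app conv.lam conv.refl)

lemma typed_lams: "typed S \<sigma> t \<rho> \<Longrightarrow> typed S [] (lams \<sigma> t) (fns (rev \<sigma>) \<rho>)"
proof (induction \<sigma> arbitrary: t \<rho>)
  case (Cons \<tau> \<sigma>)
  then show ?case using Cons.IH[OF typed.intros(7)[OF Cons.prems]] by simp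
qed simp

lemma fv_lams [simp]: "fv (lams \<sigma> t) = fv t" and supp_lams [simp]: "supp (lams \<sigma> t) = supp t"
  by (induction \<sigma> arbitrary: t) auto

text \<open>The head of \<open>\<sigma>\<close> is the innermost abstraction, so its argument is the
  last of \<open>rev us\<close>; the induction contracts the outer redexes first and this one at the
  end.\<close>

lemma conv_apps_lams:
  "length us = length \<sigma> \<Longrightarrow> conv (apps (lams \<sigma> t) (rev us)) (gsub (args_leaf us) t)"
proof (induction \<sigma> arbitrary: t us)
  case Nil
  then have "gsub (args_leaf us) t = t" by (intro gsub_ident) (auto simp: leaves_def)
  then show ?case using Nil by (simp add: conv.refl)
next
  case (Cons \<tau> \<sigma>)
  then obtain v vs where us: "us = v # vs" "length vs = length \<sigma>" by (cases us) auto
  have "conv (apps (lams \<sigma> (Lam \<tau> t)) (rev vs) \<cdot> v) (gsub (args_leaf vs) (Lam \<tau> t) \<cdot> v)"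
    by (intro conv.app conv.refl Cons.IH us(2))
  moreover have "conv (gsub (args_leaf vs) (Lam \<tau> t) \<cdot> v) (gsub (args_leaf us) t)"
    using conv.beta[of \<tau> "gsub (up (args_leaf vs)) t" v] us by (simp add: inst_args)
  ultimately show ?case using us conv.trans by auto
qed

lemma local_vars_rev: "local_vars \<sigma> = rev (map Bnd [0..<length \<sigma>])"
  by (simp add: local_vars_def rev_map)

text \<open>Typing bounds the loose indices of \<open>t\<close> by \<open>length \<sigma>\<close>,
  so \<open>args_leaf\<close> returns each of them and lowers none.\<close>

lemma conv_lams_local_vars:
  assumes "typed S \<sigma> t \<rho>"
  shows "conv (apps (lams \<sigma> t) (local_vars \<sigma>)) t"
proof -
  have "gsub (args_leaf (map Bnd [0..<length \<sigma>])) t = t"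
    using typed_fb[OF assms] by (intro gsub_ident) (auto simp: leaves_def)
  then show ?thesis using conv_apps_lams[of "map Bnd [0..<length \<sigma>]" \<sigma> t]
    by (simp add: local_vars_rev)
qed

definition var_leaf :: "'b name \<Rightarrow> ('b, 'k) tm \<Rightarrow> ('b, 'k) tm \<Rightarrow> ('b, 'k) tm" where
  "var_leaf h t x = (if x = Var h then t else x)"

text \<open>Prepares a quantification over a variable that already occurs in a sequent:
  \<open>h\<close> becomes the variable of a new outermost binder.\<close>

definition abs_var :: "'b name \<Rightarrow> ('b, 'k) tm \<Rightarrow> ('b, 'k) tm" where
  "abs_var h = gsub (\<lambda>x. if x = Var h then Bnd 0 else ren Suc x)"

lemma inst_abs_var: "inst (abs_var h B) t = gsub (var_leaf h t) B"
  unfolding inst_as_gsub abs_var_def gsub_gsub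
  by (rule gsub_cong) (auto simp: leaves_def var_leaf_def)

lemma ren_closed: "fb t = {} \<Longrightarrow> ren f t = t"
  unfolding ren_as_gsub[of f t] by (rule gsub_ident) (auto simp: leaves_def)

text \<open>A closed \<open>t\<close> is unchanged by the shifts at the binders, so the replacement
  passes through the whole prefix.\<close>

lemma gsub_var_leaf_nabs:
  assumes "fb t = {}"
  shows "gsub (var_leaf h t) (nabs \<sigma> B) = nabs \<sigma> (gsub (var_leaf h t) B)"
proof (induction \<sigma> arbitrary: B)
  case (Cons \<tau> \<sigma>)
  have "gsub (up (var_leaf h t)) B = gsub (var_leaf h t) B"
    by (rule gsub_cong)
      (auto simp: leaves_def var_leaf_def up_def ren_closed[OF assms] split: nat.split if_splits)
  then show ?case by (simp add: Cons)
qed simp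

lemma fv_abs_var: "fv (abs_var h B) \<subseteq> fv B - {h}"
  unfolding abs_var_def by (rule order_trans[OF fv_gsub]) (auto simp: leaves_def split: if_splits)

lemma supp_abs_var: "supp (abs_var h B) \<subseteq> supp B"
  unfolding abs_var_def by (rule order_trans[OF supp_gsub]) (auto simp: leaves_def split: if_splits)

lemma long_nf_abs_var: "long_nf S [] B Prop \<Longrightarrow> long_nf S [snd h] (abs_var h B) Prop"
  unfolding abs_var_def
  by (erule long_nf_gsub(1)) (auto simp: wt_subst_def intro: neutral_leaf)

section \<open>Raising over a larger list of nominal constants\<close>

text \<open>An explicit normal form of \<open>B[h cs/x]\<close>: a variable applied to expanded
  arguments is neutral and can replace \<open>x\<close> in a normal form \<open>B\<close> without
  creating a redex.\<close>

definition nf_inst_raised :: "('b, 'k) tm \<Rightarrow> 'b name \<Rightarrow> 'b name list \<Rightarrow> ('b, 'k) tm" where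
  "nf_inst_raised B h cs = inst B (apps (Var h) (map (\<lambda>c. eta_exp (snd c) (Nom c)) cs))"

lemma conv_raised:
  "conv (apps (Var h) (map Nom cs)) (apps (Var h) (map (\<lambda>c. eta_exp (snd c) (Nom c)) cs))"
  by (rule conv_apps) (auto simp: list.rel_map conv.refl intro!: list_all2_all_nthI conv.sym[OF conv_eta_exp])

lemma inst_nf_raised:
  assumes "long_nf S [\<tau>] B Prop" and "h = (n, fns (map snd cs) \<tau>)" and "snd ` set cs \<subseteq> nominal S"
  shows "inst_nf S [] B (apps (Var h) (map Nom cs)) (nf_inst_raised B h cs)"
proof -
  have "neutral S [] (apps (Var h) (map (\<lambda>c. eta_exp (snd c) (Nom c)) cs)) \<tau>"
    by (rule neutral_apps[where \<tau>s = "map snd cs"])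
      (use assms(2,3) in \<open>auto simp: list.rel_map intro!: list_all2_all_nthI long_nf_eta_exp neutral_leaf\<close>)
  then show ?thesis unfolding inst_nf_def nf_inst_raised_def
    using long_nf_inst[OF assms(1)] conv_inst[OF conv_raised] by blast
qed

lemma fv_nf_inst_raised: "fv (nf_inst_raised B h cs) \<subseteq> insert h (fv B)"
  and supp_nf_inst_raised: "supp (nf_inst_raised B h cs) \<subseteq> supp B \<union> set cs"
  using inst_fv[of B] inst_supp[of B] unfolding nf_inst_raised_def
  by (fastforce simp: fv_apps supp_apps)+

text \<open>A variable \<open>h'\<close> raised over a part \<open>cs\<close> of \<open>L\<close>
  yields a term for \<open>h\<close>, which is raised over all of \<open>L\<close>: \<open>t\<close>
  abstracts over \<open>L\<close> and passes only \<open>cs\<close> to \<open>h'\<close>. Replacing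
  \<open>h\<close> by \<open>t\<close> therefore turns the instance for \<open>h\<close> into the
  instance for \<open>h'\<close>, here inside the nabla closure, which contains no nominal
  constants.\<close>

lemma raise_over_more:
  fixes B :: "('b, 'k) tm"
  assumes B: "long_nf S (\<tau> # map snd L) B Prop" "supp B = {}"
    and L: "distinct L" "snd ` set L \<subseteq> nominal S"
    and h: "h = (n, fns (rev (map snd L)) \<tau>)" "h \<notin> fv B"
    and B': "inst_nf S (map snd L) B (apps (Var h) (local_vars (map snd L))) B'"
    and cs: "set cs \<subseteq> set L" "h' = (m, fns (map snd cs) \<tau>)"
  defines "B1 \<equiv> gsub (up (args_leaf (map Nom L))) B"
    and "t \<equiv> lams (map snd L) (abs_noms L (apps (Var h') (map Nom cs)))"
  shows "typed S [] t (snd h)" and "fv t \<subseteq> {h'}"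
    and "inst_nf S [] (abs_var h (nabs (map snd L) B')) t
           (nabs (map snd L) (abs_noms L (nf_inst_raised B1 h' cs)))"
proof -
  let ?\<sigma> = "map snd L" and ?w = "apps (Var h') (map Nom cs) :: ('b, 'k) tm"
  have "typed S [] ?w \<tau>"
    by (rule typed_apps[where \<tau>s = "map snd cs"])
      (use cs L in \<open>auto simp: list.rel_map intro!: list_all2_all_nthI nf_typed(2) neutral_leaf
        dest!: nth_mem\<close>)
  then have w: "typed S ?\<sigma> (abs_noms L ?w) \<tau>"
    unfolding abs_noms_def by (rule typed_gsub) (intro wt_subst_typed wt_subst_abs_leaf)
  show t: "typed S [] t (snd h)" unfolding t_def h(1) using typed_lams[OF w] by simp
  show "fv t \<subseteq> {h'}" unfolding t_def using fv_abs_noms[of L ?w] by (auto simp: fv_apps)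
  have "fb t = {}" using typed_fb[OF t] by auto
  have B1: "long_nf S [\<tau>] B1 Prop"
    unfolding B1_def by (rule long_nf_gsub(1)[OF B(1) wt_subst_up[OF wt_subst_ins[OF L(2)]]])
  have cs_nom: "snd ` set cs \<subseteq> nominal S" using cs L by auto
  \<comment> \<open>The variable \<open>h\<close> does not occur in \<open>B\<close>, so replacing
    it affects only the term put for the bound variable.\<close>
  have "conv (gsub (var_leaf h t) B') (gsub (var_leaf h t) (inst B (apps (Var h) (local_vars ?\<sigma>))))"
    using B' by (auto simp: inst_nf_def intro: conv_gsub conv.sym)
  also have "gsub (var_leaf h t) (inst B (apps (Var h) (local_vars ?\<sigma>))) =
      inst B (apps t (local_vars ?\<sigma>))"
  proof -
    have "gsub (up (var_leaf h t)) B = B"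
      using h(2) by (intro gsub_ident) (auto simp: leaves_def var_leaf_def up_def split: nat.split if_splits)
    then show ?thesis
      by (simp add: gsub_inst gsub_apps local_vars_def var_leaf_def comp_def)
  qed
  finally have 1: "conv (gsub (var_leaf h t) B') (inst B (apps t (local_vars ?\<sigma>)))" .
  \<comment> \<open>Applied to the local variables, \<open>t\<close> contracts to
    \<open>h' cs\<close> with the constants abstracted.\<close>
  have 2: "conv (inst B (apps t (local_vars ?\<sigma>))) (inst B (abs_noms L ?w))"
    unfolding t_def by (rule conv_inst[OF conv_lams_local_vars[OF w]])
  \<comment> \<open>\<open>B\<close> is \<open>B1\<close> with the constants abstracted again, so
    instantiation commutes with the abstraction; what remains is to expand the arguments of
    \<open>h'\<close>.\<close>
  have "gsub (up (abs_leaf L)) B1 = B" unfolding B1_def by (rule abs_ins_noms_body) (use B L in auto)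
  then have "abs_noms L (inst B1 u) = inst B (abs_noms L u)" for u
    by (simp add: abs_noms_def gsub_inst)
  then have 3: "conv (inst B (abs_noms L ?w)) (abs_noms L (nf_inst_raised B1 h' cs))"
    unfolding nf_inst_raised_def
    by (auto simp: abs_noms_def intro!: conv_inst conv_gsub conv_raised)
  have "conv (inst (abs_var h (nabs ?\<sigma> B')) t) (nabs ?\<sigma> (abs_noms L (nf_inst_raised B1 h' cs)))"
    unfolding inst_abs_var gsub_var_leaf_nabs[OF \<open>fb t = {}\<close>]
    using conv_nabs 1 2 3 conv.trans by metis
  moreover have "long_nf S [] (nabs ?\<sigma> (abs_noms L (nf_inst_raised B1 h' cs))) Prop"
  proof -
    have "supp B1 \<subseteq> set L" unfolding B1_def
      using supp_ins_noms[of L "Lam Prop B"] B(2) by simp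
    then have "supp (nf_inst_raised B1 h' cs) \<subseteq> set L"
      using supp_nf_inst_raised[of B1 h' cs] cs(1) by blast
    moreover have "formula S (fv (nf_inst_raised B1 h' cs)) (nf_inst_raised B1 h' cs)"
      using inst_nf_raised[OF B1 cs(2) cs_nom] by (simp add: formula_def inst_nf_def)
    ultimately show ?thesis
      using wf_judgment_nabs wf_judgment_abs_noms L(2) by (metis wf_judgment.simps)
  qed
  ultimately show "inst_nf S [] (abs_var h (nabs ?\<sigma> B')) t
           (nabs ?\<sigma> (abs_noms L (nf_inst_raised B1 h' cs)))" by (simp add: inst_nf_def)
qed

section \<open>From \<open>FO\<lambda>\<nabla>\<close> to LG\<close>

lemma LG_wf: "LG S \<Sigma> \<Gamma> C \<Longrightarrow> wf_LG S \<Sigma> \<Gamma> C"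
  by (erule LG.cases) auto

lemma is_perm_id: "is_perm (\<lambda>a. a)"
  using bij_id by (simp add: is_perm_def id_def)

lemma LG_id: "wf_LG S \<Sigma> (add_mset B \<Gamma>) B \<Longrightarrow> LG S \<Sigma> (add_mset B \<Gamma>) B"
  using LG.id_perm is_perm_id by blast

lemma LG_cut:
  assumes "LG S \<Sigma> \<Delta> B" and "LG S \<Sigma> (add_mset B \<Gamma>) C"
  shows "LG S \<Sigma> (\<Delta> + \<Gamma>) C"
proof -
  have "wf_LG S \<Sigma> (\<Delta> + \<Gamma>) C"
    using LG_wf[OF assms(1)] LG_wf[OF assms(2)] by (auto simp: wf_LG_def)
  then show ?thesis
    using LG.multicut[of S \<Sigma> "[\<Delta>]" \<Gamma> C "[B]"] assms by simp
qed

text \<open>The identity rule admits side formulas, so cutting \<open>C\<close> against an identity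
  on \<open>C\<close> with \<open>B\<close> beside it puts \<open>B\<close> into the
  context.\<close>

lemma LG_weaken:
  assumes "LG S \<Sigma> \<Gamma> C" and "formula S \<Sigma> B"
  shows "LG S \<Sigma> (add_mset B \<Gamma>) C"
proof -
  have "LG S \<Sigma> (add_mset C {#B#}) C"
    using LG_wf[OF assms(1)] assms(2) by (intro LG_id) (auto simp: wf_LG_def)
  then show ?thesis using LG_cut[OF assms(1)] by fastforce
qed

lemma formula_mono: "formula S \<Sigma> B \<Longrightarrow> \<Sigma> \<subseteq> \<Sigma>' \<Longrightarrow> formula S \<Sigma>' B"
  by (auto simp: formula_def)

lemma supp_ins_noms_body:
  "supp (gsub (up (args_leaf (map Nom L))) B) \<subseteq> supp B \<union> set L"
  using supp_ins_noms[of L "Lam Prop B"] by simp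

text \<open>The head of \<open>L\<close> belongs to the innermost quantifier, which is introduced
  first. Its constant is fresh: \<open>B\<close> has no support, so the body contains only the other
  constants of the distinct list \<open>L\<close>.\<close>

lemma LG_nabs:
  assumes "wf_judgment S \<Sigma> (map snd L, B)" and "distinct L"
  shows LG_nabsR: "LG S \<Sigma> \<Gamma> (ins_noms L B) \<Longrightarrow> LG S \<Sigma> \<Gamma> (nabs (map snd L) B)"
    and LG_nabsL: "LG S \<Sigma> (add_mset (ins_noms L B) \<Gamma>) C \<Longrightarrow>
      LG S \<Sigma> (add_mset (nabs (map snd L) B) \<Gamma>) C"
proof -
  have "(LG S \<Sigma> \<Gamma> (ins_noms L B) \<longrightarrow> LG S \<Sigma> \<Gamma> (nabs (map snd L) B)) \<and>
    (LG S \<Sigma> (add_mset (ins_noms L B) \<Gamma>) C \<longrightarrow> LG S \<Sigma> (add_mset (nabs (map snd L) B) \<Gamma>) C)"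
    using assms
  proof (induction L arbitrary: B)
    case (Cons a L)
    obtain n \<tau> where a: "a = (n, \<tau>)" by (cases a)
    let ?B = "gsub (up (args_leaf (map Nom L))) B"
    have wf: "wf_judgment S \<Sigma> (map snd L, FNab \<tau> B)"
      using Cons.prems(1) a by (subst wf_judgment_FNab) simp
    then have form: "formula S \<Sigma> (FNab \<tau> ?B)"
      using formula_ins_noms[OF wf] by simp
    have fresh: "(n, \<tau>) \<notin> supp ?B"
      using supp_ins_noms_body[of L B] Cons.prems a by auto
    have inst: "ins_noms (a # L) B = inst ?B (Nom (n, \<tau>))" by (simp add: ins_noms_Cons a)
    have "LG S \<Sigma> \<Gamma> (FNab \<tau> ?B)" if "LG S \<Sigma> \<Gamma> (ins_noms (a # L) B)"
      using LG_wf[OF that] that fresh form unfolding inst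
      by (intro LG.NabR) (auto simp: wf_LG_def)
    moreover have "LG S \<Sigma> (add_mset (FNab \<tau> ?B) \<Gamma>) C"
      if "LG S \<Sigma> (add_mset (ins_noms (a # L) B) \<Gamma>) C"
      using LG_wf[OF that] that fresh form unfolding inst
      by (intro LG.NabL) (auto simp: wf_LG_def)
    ultimately show ?case using Cons.IH[OF wf] Cons.prems(2) a by simp
  qed simp
  then show "LG S \<Sigma> \<Gamma> (ins_noms L B) \<Longrightarrow> LG S \<Sigma> \<Gamma> (nabs (map snd L) B)"
    and "LG S \<Sigma> (add_mset (ins_noms L B) \<Gamma>) C \<Longrightarrow> LG S \<Sigma> (add_mset (nabs (map snd L) B) \<Gamma>) C"
    by auto
qed

lemma ex_fresh_index: "finite A \<Longrightarrow> \<exists>n. (n, \<tau>) \<notin> A" for A :: "'b name set"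
proof -
  assume "finite A"
  then have "finite (fst ` A)" by simp
  then obtain n where "n \<notin> fst ` A" using ex_new_if_finite infinite_UNIV_nat by metis
  then show ?thesis by force
qed

text \<open>With empty support the eigenvariable is raised over the empty list, so \<open>h\<close>
  itself serves as eigenvariable, even if its own type is a raised one.\<close>

lemma LG_generalize:
  assumes h: "h \<notin> \<Sigma>" "prop_free (snd h)" and B: "supp B = {}" and \<Sigma>: "finite \<Sigma>"
  shows LG_generalizeR: "LG S (insert h \<Sigma>) \<Gamma> B \<Longrightarrow> \<forall>D \<in># \<Gamma>. formula S \<Sigma> D \<Longrightarrow>
      LG S \<Sigma> \<Gamma> (FAll (snd h) (abs_var h B))"
    and LG_generalizeL: "LG S (insert h \<Sigma>) (add_mset B \<Gamma>) C \<Longrightarrow>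
      \<forall>D \<in># add_mset C \<Gamma>. formula S \<Sigma> D \<Longrightarrow> LG S \<Sigma> (add_mset (FEx (snd h) (abs_var h B)) \<Gamma>) C"
proof -
  have hB: "gsub (var_leaf h (Var h)) B = B"
    by (rule gsub_ident) (auto simp: var_leaf_def)
  have body: "long_nf S [snd h] (abs_var h B) Prop \<and> fv (abs_var h B) \<subseteq> \<Sigma> \<and>
      inst_nf S [] (abs_var h B) (Var h) B" if "formula S (insert h \<Sigma>) B"
    using that long_nf_abs_var[of S B h] fv_abs_var[of h B]
    by (auto simp: formula_def inst_nf_def inst_abs_var hB conv.refl)
  have supp: "supp (abs_var h B) = {}" using supp_abs_var[of h B] B by simp
  have h_eq: "h = (fst h, fns (map snd []) (snd h))" by simp
  {
    assume L: "LG S (insert h \<Sigma>) \<Gamma> B" and \<Gamma>: "\<forall>D \<in># \<Gamma>. formula S \<Sigma> D"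
    note b = body[OF conjunct2[OF conjunct2[OF LG_wf[OF L, unfolded wf_LG_def]]]]
    show "LG S \<Sigma> \<Gamma> (FAll (snd h) (abs_var h B))"
      by (rule LG.AllR[where cs = "[]", OF _ _ _ h_eq h(1) _ L])
        (use b \<Gamma> \<Sigma> h supp in \<open>auto simp: wf_LG_def formula_def\<close>)
  }
  {
    assume L: "LG S (insert h \<Sigma>) (add_mset B \<Gamma>) C"
      and \<Gamma>: "\<forall>D \<in># add_mset C \<Gamma>. formula S \<Sigma> D"
    have b: "long_nf S [snd h] (abs_var h B) Prop \<and> fv (abs_var h B) \<subseteq> \<Sigma> \<and>
      inst_nf S [] (abs_var h B) (Var h) B"
      using LG_wf[OF L] by (intro body) (simp add: wf_LG_def)
    show "LG S \<Sigma> (add_mset (FEx (snd h) (abs_var h B)) \<Gamma>) C"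
      by (rule LG.ExL[where cs = "[]", OF _ _ _ h_eq h(1) _ L])
        (use b \<Gamma> \<Sigma> h supp in \<open>auto simp: wf_LG_def formula_def\<close>)
  }
qed

text \<open>The variable \<open>h\<close> is raised over all of \<open>L\<close>, while the rules of LG raise a new variable over
  the support only. The \<open>\<nabla>\<close>-closure of the instance has empty support, so LG can generalize
  over \<open>h\<close> itself; the original quantified formula is then recovered by a cut.\<close>

lemma LG_quantifier_raised:
  fixes B :: "('b, 'k) tm"
  assumes S: "wf_lang S" and \<Sigma>: "finite \<Sigma>"
    and B: "wf_judgment S \<Sigma> (map snd L, FAll \<tau> B)" and L: "distinct L"
    and h: "h = (n, fns (rev (map snd L)) \<tau>)" "h \<notin> \<Sigma>"
    and B': "inst_nf S (map snd L) B (apps (Var h) (local_vars (map snd L))) B'"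
      "wf_judgment S (insert h \<Sigma>) (map snd L, B')"
  shows LG_AllR_raised: "LG S (insert h \<Sigma>) \<Gamma> (ins_noms L B') \<Longrightarrow> \<forall>D \<in># \<Gamma>. formula S \<Sigma> D \<Longrightarrow>
      LG S \<Sigma> \<Gamma> (ins_noms L (FAll \<tau> B))"
    and LG_ExL_raised: "LG S (insert h \<Sigma>) (add_mset (ins_noms L B') \<Gamma>) C \<Longrightarrow>
      \<forall>D \<in># add_mset C \<Gamma>. formula S \<Sigma> D \<Longrightarrow> LG S \<Sigma> (add_mset (ins_noms L (FEx \<tau> B)) \<Gamma>) C"
proof -
  define B1 where "B1 = gsub (up (args_leaf (map Nom L))) B"
  have Lnom: "snd ` set L \<subseteq> nominal S" using B by simp
  have lnB: "long_nf S (\<tau> # map snd L) B Prop" "supp B = {}" "fv B \<subseteq> \<Sigma>" "prop_free \<tau>"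
    using B by auto
  have B1: "formula S \<Sigma> (FAll \<tau> B1)" using formula_ins_noms[OF B] by (simp add: B1_def)
  then have B1': "long_nf S [\<tau>] B1 Prop" "fv B1 \<subseteq> \<Sigma>" by (auto simp: formula_def)
  have suppB1: "supp B1 \<subseteq> set L" using supp_ins_noms_body[of L B] lnB by (simp add: B1_def)
  obtain cs where cs: "distinct cs" "set cs = supp B1"
    using finite_distinct_list finite_supp by metis
  obtain m where m: "(m, fns (map snd cs) \<tau>) \<notin> \<Sigma>" using ex_fresh_index[OF \<Sigma>] by blast
  define h' where "h' = (m, fns (map snd cs) \<tau>)"
  have h': "h' \<notin> \<Sigma>" using m by (simp add: h'_def)
  define Bs where "Bs = nf_inst_raised B1 h' cs"
  have csnom: "snd ` set cs \<subseteq> nominal S" using cs suppB1 Lnom by auto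
  have Bs: "inst_nf S [] B1 (apps (Var h') (map Nom cs)) Bs" unfolding Bs_def
    by (rule inst_nf_raised[OF B1'(1) h'_def csnom])
  have formBs: "formula S (insert h' \<Sigma>) Bs"
    using Bs B1' fv_nf_inst_raised[of B1 h' cs] by (auto simp: formula_def inst_nf_def Bs_def)
  have suppBs: "supp Bs \<subseteq> set L"
    using supp_nf_inst_raised[of B1 h' cs] cs suppB1 by (auto simp: Bs_def)
  note wfBs = wf_judgment_abs_noms[OF formBs suppBs Lnom]
  define t where "t = lams (map snd L) (abs_noms L (apps (Var h') (map Nom cs) :: ('b, 'k) tm))"
  have csL: "set cs \<subseteq> set L" and hB: "h \<notin> fv B" using cs suppB1 lnB h by auto
  have t: "typed S [] t (snd h)" "fv t \<subseteq> {h'}"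
    "inst_nf S [] (abs_var h (nabs (map snd L) B')) t (nabs (map snd L) (abs_noms L Bs))"
    using raise_over_more[OF lnB(1,2) L Lnom h(1) hB B'(1) csL h'_def] unfolding t_def Bs_def B1_def
    by auto
  define G0 where "G0 = nabs (map snd L) B'"
  have G0: "formula S (insert h \<Sigma>) G0" "supp G0 = {}"
    using wf_judgment_nabs[of S "insert h \<Sigma>" "map snd L" B'] B'(2) by (auto simp: G0_def formula_def)
  \<comment> \<open>Quantifying over \<open>h\<close> yields a formula only if \<open>o\<close> does
    not occur in its type; for the argument types of \<open>h\<close>, which are nominal, this is
    \<open>wf_lang\<close>.\<close>
  have hpf: "prop_free (snd h)"
    using S Lnom lnB by (auto simp: h prop_free_fns wf_lang_def)
  have body: "long_nf S [snd h] (abs_var h G0) Prop" "fv (abs_var h G0) \<subseteq> \<Sigma>"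
    using long_nf_abs_var[of S G0 h] fv_abs_var[of h G0] G0 by (auto simp: formula_def)
  have nBs: "formula S (insert h' \<Sigma>) (nabs (map snd L) (abs_noms L Bs))"
    using wf_judgment_nabs[of S "insert h' \<Sigma>" "map snd L" "abs_noms L Bs"] wfBs
    by (simp add: formula_def)
  have idBs: "LG S (insert h' \<Sigma>) {#Bs#} Bs"
    using formBs \<Sigma> by (intro LG_id) (simp add: wf_LG_def)
  {
    assume LGp: "LG S (insert h \<Sigma>) \<Gamma> (ins_noms L B')" and \<Gamma>: "\<forall>D \<in># \<Gamma>. formula S \<Sigma> D"
    let ?G = "FAll (snd h) (abs_var h G0)"
    have formG: "formula S \<Sigma> ?G" using body hpf by (auto simp: formula_def)
    have 1: "LG S \<Sigma> \<Gamma> ?G"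
      using LG_generalizeR[OF h(2) hpf G0(2) \<Sigma> _ \<Gamma>] LG_nabsR[OF B'(2) L LGp] by (simp add: G0_def)
    \<comment> \<open>This closure is the instance of \<open>?G\<close> at \<open>t\<close>. Opened
      with the constants of \<open>L\<close> it is \<open>Bs\<close>, the instance from which LG
      generalizes over \<open>h'\<close>.\<close>
    have "LG S (insert h' \<Sigma>) {#nabs (map snd L) (abs_noms L Bs)#} Bs"
      using LG_nabsL[OF wfBs L, of "{#}" Bs] idBs by simp
    then have "LG S (insert h' \<Sigma>) {#?G#} Bs"
      by (rule LG.AllL[rotated 4])
        (use formG formBs \<Sigma> t in \<open>auto simp: wf_LG_def G0_def intro: formula_mono\<close>)
    then have "LG S \<Sigma> {#?G#} (FAll \<tau> B1)"
      by (rule LG.AllR[rotated 6])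
        (use cs h'_def h' Bs formG B1 \<Sigma> in \<open>auto simp: wf_LG_def\<close>)
    then show "LG S \<Sigma> \<Gamma> (ins_noms L (FAll \<tau> B))"
      using LG_cut[OF 1, of "{#}"] by (simp add: B1_def)
  }
  {
    assume LGp: "LG S (insert h \<Sigma>) (add_mset (ins_noms L B') \<Gamma>) C"
      and \<Gamma>: "\<forall>D \<in># add_mset C \<Gamma>. formula S \<Sigma> D"
    let ?G = "FEx (snd h) (abs_var h G0)"
    have formG: "formula S \<Sigma> ?G" using body hpf by (auto simp: formula_def)
    have formE: "formula S \<Sigma> (FEx \<tau> B1)" using B1 by (auto simp: formula_def)
    have 1: "LG S \<Sigma> (add_mset ?G \<Gamma>) C"
      using LG_generalizeL[OF h(2) hpf G0(2) \<Sigma> _ \<Gamma>] LG_nabsL[OF B'(2) L LGp] by (simp add: G0_def)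
    \<comment> \<open>Dually, \<open>Bs\<close> entails its nabla closure, and \<open>t\<close> is
      the witness that turns this closure into \<open>?G\<close>.\<close>
    have "LG S (insert h' \<Sigma>) {#Bs#} (nabs (map snd L) (abs_noms L Bs))"
      using LG_nabsR[OF wfBs L, of "{#Bs#}"] idBs by simp
    then have "LG S (insert h' \<Sigma>) {#Bs#} ?G"
      by (rule LG.ExR[rotated 4])
        (use formG formBs \<Sigma> t in \<open>auto simp: wf_LG_def G0_def intro: formula_mono\<close>)
    then have "LG S \<Sigma> {#FEx \<tau> B1#} ?G"
      by (rule LG.ExL[rotated 6])
        (use cs h'_def h' Bs formG formE \<Sigma> in \<open>auto simp: wf_LG_def\<close>)
    then show "LG S \<Sigma> (add_mset (ins_noms L (FEx \<tau> B)) \<Gamma>) C"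
      using LG_cut[OF _ 1, of "{#FEx \<tau> B1#}"] by (simp add: B1_def)
  }
qed

section \<open>Translating judgements to LG formulas\<close>

primrec canon_noms :: "'b ty list \<Rightarrow> 'b name list" where
  "canon_noms [] = []"
| "canon_noms (\<tau> # \<sigma>) = (length \<sigma>, \<tau>) # canon_noms \<sigma>"

lemma map_snd_canon_noms [simp]: "map snd (canon_noms \<sigma>) = \<sigma>"
  by (induction \<sigma>) auto

text \<open>The index of a constant counts the older local variables, so indices never repeat
  whatever the types, and extending the signature keeps the older constants.\<close>

lemma distinct_canon_noms [simp]: "distinct (canon_noms \<sigma>)"
proof (induction \<sigma>)
  case (Cons \<tau> \<sigma>)
  have "fst ` set (canon_noms \<sigma>) \<subseteq> {..<length \<sigma>}" for \<sigma> :: "'a ty list" by (induction \<sigma>) auto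
  from this[of \<sigma>] Cons show ?case by force
qed simp

definition to_LG :: "('b, 'k) gjudgment \<Rightarrow> ('b, 'k) tm" where
  "to_LG J = ins_noms (canon_noms (fst J)) (snd J)"

lemma formula_to_LG: "wf_judgment S \<Sigma> J \<Longrightarrow> formula S \<Sigma> (to_LG J)"
  using formula_ins_noms[of S \<Sigma> "canon_noms (fst J)" "snd J"] by (cases J) (simp add: to_LG_def)

lemma wf_to_LG: "wf_FO S \<Sigma> \<Gamma> J \<Longrightarrow> wf_LG S \<Sigma> (image_mset to_LG \<Gamma>) (to_LG J)"
  by (auto simp: wf_FO_def wf_LG_def intro: formula_to_LG)

lemma to_LG_simps:
  "to_LG (\<sigma>, Log c) = Log c"
  "to_LG (\<sigma>, Log c \<cdot> B \<cdot> C) = Log c \<cdot> to_LG (\<sigma>, B) \<cdot> to_LG (\<sigma>, C)"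
  "to_LG (\<sigma>, Log c \<cdot> Lam \<tau> B) =
     Log c \<cdot> Lam \<tau> (gsub (up (args_leaf (map Nom (canon_noms \<sigma>)))) B)"
  by (simp_all add: to_LG_def)

lemma to_LG_Cons:
  "to_LG (\<tau> # \<sigma>, B) =
     inst (gsub (up (args_leaf (map Nom (canon_noms \<sigma>)))) B) (Nom (length \<sigma>, \<tau>))"
  by (simp add: to_LG_def ins_noms_Cons)

lemma FO_wf: "FO_nabla S \<Sigma> \<Gamma> J \<Longrightarrow> wf_FO S \<Sigma> \<Gamma> J"
  by (erule FO_nabla.cases) auto

lemma nabla_axiom_gsub:
  assumes "nabla_axiom A"
  shows "nabla_axiom (gsub \<theta> A)"
  using assms
proof cases
  case (vacuous B \<tau>)
  then show ?thesis using nabla_axiom.vacuous by (simp add: FEquiv_def gsub_up_ren_Suc)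
next
  case (exchange \<tau> \<rho> B)
  have "gsub (up (up \<theta>)) (ren (id(0 := 1, 1 := 0)) B) = ren (id(0 := 1, 1 := 0)) (gsub (up (up \<theta>)) B)"
    unfolding gsub_ren ren_gsub
    by (rule gsub_cong) (auto simp: leaves_def up_def split: nat.split)
  then show ?thesis using exchange nabla_axiom.exchange by simp
qed

text \<open>Opened with fresh constants, the two sides become the same formula: in the vacuous case
  \<open>inst\<close> cancels the shift, in the exchange case both orders of instantiation give
  \<open>E\<close>.\<close>

lemma LG_nabla_axiom:
  assumes "nabla_axiom A" and wf: "wf_LG S \<Sigma> \<Gamma> A"
  shows "LG S \<Sigma> \<Gamma> A"
  using assms(1)
proof cases
  case (vacuous B \<tau>)
  obtain n where n: "(n, \<tau>) \<notin> supp (ren Suc B)" using ex_fresh_index finite_supp by metis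
  have f: "formula S \<Sigma> B" "formula S \<Sigma> (FNab \<tau> (ren Suc B))"
    and g: "finite \<Sigma>" "\<forall>D \<in># \<Gamma>. formula S \<Sigma> D"
    using wf vacuous by (auto simp: wf_LG_def formula_def FEquiv_def)
  have "LG S \<Sigma> (add_mset B \<Gamma>) B" using f g by (intro LG_id) (auto simp: wf_LG_def)
  then have "LG S \<Sigma> (add_mset B \<Gamma>) (FNab \<tau> (ren Suc B))"
    "LG S \<Sigma> (add_mset (FNab \<tau> (ren Suc B)) \<Gamma>) B"
    using f g n by (auto intro!: LG.NabL LG.NabR simp: wf_LG_def)
  then show ?thesis using f g unfolding vacuous FEquiv_def
    by (intro LG.AndR LG.ImpR) (auto simp: wf_LG_def formula_def)
next
  case (exchange \<tau> \<rho> B)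
  let ?sw = "ren (id(0 := 1, 1 := 0)) B"
  obtain a where a: "(a, \<tau>) \<notin> supp B" using ex_fresh_index finite_supp by metis
  \<comment> \<open>The types \<open>\<tau>\<close> and \<open>\<rho>\<close> may coincide, so the
    second constant must also avoid the first.\<close>
  obtain b where b: "(b, \<rho>) \<notin> insert (a, \<tau>) (supp B)"
    using ex_fresh_index finite_supp finite_insert by metis
  have f: "formula S \<Sigma> (FNab \<tau> (FNab \<rho> B))" "formula S \<Sigma> (FNab \<rho> (FNab \<tau> ?sw))"
    and g: "finite \<Sigma>" "\<forall>D \<in># \<Gamma>. formula S \<Sigma> D"
    using wf exchange by (auto simp: wf_LG_def formula_def)
  let ?up = "\<lambda>x. gsub (up (sub (case_nat (Nom x) Bnd)))"
  have eq: "inst (?up (a, \<tau>) B) (Nom (b, \<rho>)) = inst (?up (b, \<rho>) ?sw) (Nom (a, \<tau>))"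
    unfolding inst_as_gsub gsub_gsub gsub_ren
    by (rule gsub_cong) (auto simp: leaves_def up_def split: nat.split)
  have inst_Nab: "inst (FNab \<upsilon> D) (Nom x) = FNab \<upsilon> (?up x D)" for \<upsilon> D x
    by (simp add: inst_as_gsub)
  have form_inst: "formula S \<Sigma> (inst D (Nom (x, \<upsilon>)))" if "formula S \<Sigma> (FNab \<upsilon> D)" for \<upsilon> D x
    using that inst_fv[of D "Nom (x, \<upsilon>)"]
    by (auto simp: formula_def intro!: long_nf_inst neutral_leaf)
  have supp_up: "supp (?up x D) \<subseteq> insert x (supp D)" for x D
    by (rule order_trans[OF supp_gsub]) (auto simp: leaves_def up_def split: nat.split nat.splits)
  define E where "E = inst (?up (a, \<tau>) B) (Nom (b, \<rho>))"
  have f1: "formula S \<Sigma> (FNab \<rho> (?up (a, \<tau>) B))" "formula S \<Sigma> (FNab \<tau> (?up (b, \<rho>) ?sw))"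
    using form_inst[OF f(1)] form_inst[OF f(2)] inst_Nab by metis+
  have "formula S \<Sigma> E" using form_inst[OF f1(1)] by (simp add: E_def)
  then have "LG S \<Sigma> (add_mset E \<Gamma>) E" using g by (intro LG_id) (auto simp: wf_LG_def)
  then have "LG S \<Sigma> (add_mset E \<Gamma>) (FNab \<tau> (?up (b, \<rho>) ?sw))"
    using f1(2) g \<open>formula S \<Sigma> E\<close> a b supp_up[of "(b, \<rho>)" ?sw] unfolding E_def eq
    by (intro LG.NabR) (auto simp: wf_LG_def)
  then have "LG S \<Sigma> (add_mset E \<Gamma>) (FNab \<rho> (FNab \<tau> ?sw))"
    using f(2) g \<open>formula S \<Sigma> E\<close> a b inst_Nab[of \<tau> ?sw "(b, \<rho>)"]
    by (intro LG.NabR[of _ _ _ _ _ b]) (auto simp: wf_LG_def)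
  then have "LG S \<Sigma> (add_mset (FNab \<rho> (?up (a, \<tau>) B)) \<Gamma>) (FNab \<rho> (FNab \<tau> ?sw))"
    using f f1 g a b supp_up[of "(a, \<tau>)" B] unfolding E_def
    by (intro LG.NabL) (auto simp: wf_LG_def)
  then have "LG S \<Sigma> (add_mset (FNab \<tau> (FNab \<rho> B)) \<Gamma>) (FNab \<rho> (FNab \<tau> ?sw))"
    using f g a b inst_Nab[of \<rho> B "(a, \<tau>)"]
    by (intro LG.NabL[of _ _ _ _ _ _ a]) (auto simp: wf_LG_def)
  then show ?thesis using wf unfolding exchange by (intro LG.ImpR)
qed

lemma supp_to_LG_body:
  "supp B = {} \<Longrightarrow> (length \<sigma>, \<tau>) \<notin> supp (gsub (up (args_leaf (map Nom (canon_noms \<sigma>)))) B)"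
  using supp_ins_noms_body[of "canon_noms \<sigma>" B] distinct_canon_noms[of "\<tau> # \<sigma>"] by auto

text \<open>Nominal constants are neutral, so putting them for local variables preserves long
  normality as well as \<open>conv\<close>.\<close>

lemma inst_nf_to_LG:
  assumes "inst_nf S \<sigma> B t B'" "set \<sigma> \<subseteq> nominal S"
  shows "inst_nf S [] (gsub (up (args_leaf (map Nom (canon_noms \<sigma>)))) B)
    (ins_noms (canon_noms \<sigma>) t) (to_LG (\<sigma>, B'))"
proof -
  have "snd ` set (canon_noms \<sigma>) \<subseteq> nominal S"
    using assms(2) map_snd_canon_noms[of \<sigma>] by (metis set_map)
  then have "wt_subst S \<sigma> [] (args_leaf (map Nom (canon_noms \<sigma>)))"
    using wt_subst_ins by fastforce
  then show ?thesis
    using assms(1) by (auto simp: inst_nf_def to_LG_def ins_noms_def simp flip: gsub_inst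
      intro: conv_gsub long_nf_gsub(1))
qed

lemma local_term_ins_noms:
  assumes "local_term S \<Sigma> \<sigma> t \<tau>" "set \<sigma> \<subseteq> nominal S"
  shows "typed S [] (ins_noms (canon_noms \<sigma>) t) \<tau>" and "fv (ins_noms (canon_noms \<sigma>) t) \<subseteq> \<Sigma>"
proof -
  have "snd ` set (canon_noms \<sigma>) \<subseteq> nominal S"
    using assms(2) map_snd_canon_noms[of \<sigma>] by (metis set_map)
  then have "wt_subst S \<sigma> [] (args_leaf (map Nom (canon_noms \<sigma>)))"
    using wt_subst_ins by fastforce
  then show "typed S [] (ins_noms (canon_noms \<sigma>) t) \<tau>"
    using assms(1) by (auto simp: local_term_def ins_noms_def intro: typed_gsub wt_subst_typed)
  show "fv (ins_noms (canon_noms \<sigma>) t) \<subseteq> \<Sigma>"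
    using assms(1) fv_ins_noms[of "canon_noms \<sigma>" t] by (auto simp: local_term_def)
qed

lemma FO_nabla_imp_LG:
  assumes "FO_nabla S \<Sigma> \<Gamma> J" and S: "wf_lang S"
  shows "LG S \<Sigma> (image_mset to_LG \<Gamma>) (to_LG J)"
  using assms(1)
proof (induction rule: FO_nabla.induct)
  case (axiom \<Sigma> \<Gamma> \<sigma> A)
  then show ?case
    using LG_nabla_axiom wf_to_LG nabla_axiom_gsub by (metis to_LG_def ins_noms_def snd_conv)
next
  case (id \<Sigma> J \<Gamma>)
  then show ?case using wf_to_LG[OF id] by (simp add: LG_id)
next
  case (cut \<Sigma> \<Delta> \<Gamma> J I)
  then show ?case by (simp add: LG_cut)
next
  case (contrL \<Sigma> I \<Gamma> J)
  then show ?case using wf_to_LG[OF contrL(1)] by (auto intro: LG.contrL)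
next
  case (weakL \<Sigma> I \<Gamma> J)
  then show ?case by (auto simp: wf_FO_def intro!: LG_weaken formula_to_LG)
next
  case (FalseL \<Sigma> \<sigma> \<Gamma> J)
  then show ?case using wf_to_LG[OF FalseL] by (auto simp: to_LG_simps intro: LG.FalseL)
next
  case (TrueR \<Sigma> \<Gamma> \<sigma>)
  then show ?case using wf_to_LG[OF TrueR] by (auto simp: to_LG_simps intro: LG.TrueR)
next
  case (AndL1 \<Sigma> \<sigma> B D \<Gamma> J)
  then show ?case using wf_to_LG[OF AndL1(1)] by (auto simp: to_LG_simps intro: LG.AndL1)
next
  case (AndL2 \<Sigma> \<sigma> B D \<Gamma> J)
  then show ?case using wf_to_LG[OF AndL2(1)] by (auto simp: to_LG_simps intro: LG.AndL2)
next
  case (AndR \<Sigma> \<Gamma> \<sigma> B C)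
  then show ?case using wf_to_LG[OF AndR(1)] by (auto simp: to_LG_simps intro: LG.AndR)
next
  case (OrL \<Sigma> \<sigma> B D \<Gamma> J)
  then show ?case using wf_to_LG[OF OrL(1)] by (auto simp: to_LG_simps intro: LG.OrL)
next
  case (OrR1 \<Sigma> \<Gamma> \<sigma> B C)
  then show ?case using wf_to_LG[OF OrR1(1)] by (auto simp: to_LG_simps intro: LG.OrR1)
next
  case (OrR2 \<Sigma> \<Gamma> \<sigma> B C)
  then show ?case using wf_to_LG[OF OrR2(1)] by (auto simp: to_LG_simps intro: LG.OrR2)
next
  case (ImpL \<Sigma> \<sigma> B D \<Gamma> J)
  then show ?case using wf_to_LG[OF ImpL(1)] by (auto simp: to_LG_simps intro: LG.ImpL)
next
  case (ImpR \<Sigma> \<Gamma> \<sigma> B C)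
  then show ?case using wf_to_LG[OF ImpR(1)] by (auto simp: to_LG_simps intro: LG.ImpR)
next
  case (AllL \<Sigma> \<sigma> \<tau> B \<Gamma> J t B')
  have \<sigma>: "set \<sigma> \<subseteq> nominal S" using AllL(1) by (auto simp: wf_FO_def)
  show ?case using wf_to_LG[OF AllL(1)] AllL(5) inst_nf_to_LG[OF AllL(3) \<sigma>]
      local_term_ins_noms[OF AllL(2) \<sigma>]
    by (auto simp: to_LG_simps intro!: LG.AllL[where t = "ins_noms (canon_noms \<sigma>) t"])
next
  case (AllR \<Sigma> \<Gamma> \<sigma> \<tau> B h n B')
  show ?case unfolding to_LG_def fst_conv snd_conv
    by (rule LG_AllR_raised[OF S, where n = n and h = h and B' = B'])
      (use AllR FO_wf[OF AllR(5)] in \<open>auto simp: wf_FO_def to_LG_def intro: formula_to_LG[unfolded to_LG_def]\<close>)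
next
  case (ExL \<Sigma> \<sigma> \<tau> B \<Gamma> J h n B')
  show ?case unfolding to_LG_def fst_conv snd_conv image_mset_add_mset
    by (rule LG_ExL_raised[OF S, where n = n and h = h and B' = B'])
      (use ExL FO_wf[OF ExL(5)] in \<open>auto simp: wf_FO_def to_LG_def intro: formula_to_LG[unfolded to_LG_def]\<close>)
next
  case (ExR \<Sigma> \<Gamma> \<sigma> \<tau> B t B')
  have \<sigma>: "set \<sigma> \<subseteq> nominal S" using ExR(1) by (auto simp: wf_FO_def)
  show ?case using wf_to_LG[OF ExR(1)] ExR(5) inst_nf_to_LG[OF ExR(3) \<sigma>]
      local_term_ins_noms[OF ExR(2) \<sigma>]
    by (auto simp: to_LG_simps intro!: LG.ExR[where t = "ins_noms (canon_noms \<sigma>) t"])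
next
  case (NabL \<Sigma> \<sigma> \<tau> B \<Gamma> J)
  then have "supp B = {}" by (simp add: wf_FO_def)
  then show ?case using wf_to_LG[OF NabL(1)] NabL(3) supp_to_LG_body[of B \<sigma> \<tau>]
    by (auto simp: to_LG_simps to_LG_Cons intro: LG.NabL)
next
  case (NabR \<Sigma> \<Gamma> \<sigma> \<tau> B)
  then have "supp B = {}" by (simp add: wf_FO_def)
  then show ?case using wf_to_LG[OF NabR(1)] NabR(3) supp_to_LG_body[of B \<sigma> \<tau>]
    by (auto simp: to_LG_simps to_LG_Cons intro: LG.NabR)
qed

section \<open>From LG to \<open>FO\<lambda>\<nabla>\<close>\<close>

lemma FO_id: "finite \<Sigma> \<Longrightarrow> wf_judgment S \<Sigma> J \<Longrightarrow> FO_nabla S \<Sigma> {#J#} J"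
  by (rule FO_nabla.id) (simp add: wf_FO_def)

lemma FO_cutL:
  assumes "FO_nabla S \<Sigma> \<Delta> I" and "FO_nabla S \<Sigma> (add_mset I \<Gamma>) J"
  shows "FO_nabla S \<Sigma> (\<Delta> + \<Gamma>) J"
  by (rule FO_nabla.cut[OF _ assms])
    (use FO_wf[OF assms(1)] FO_wf[OF assms(2)] in \<open>auto simp: wf_FO_def\<close>)

lemma FO_trans: "FO_nabla S \<Sigma> \<Gamma> I \<Longrightarrow> FO_nabla S \<Sigma> {#I#} J \<Longrightarrow> FO_nabla S \<Sigma> \<Gamma> J"
  using FO_cutL[of S \<Sigma> \<Gamma> I "{#}" J] by simp

lemma FO_replaceL:
  "FO_nabla S \<Sigma> {#I'#} I \<Longrightarrow> FO_nabla S \<Sigma> (add_mset I \<Gamma>) J \<Longrightarrow> FO_nabla S \<Sigma> (add_mset I' \<Gamma>) J"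
  using FO_cutL[of S \<Sigma> "{#I'#}" I \<Gamma> J] by simp

lemma FO_multicut:
  assumes "length \<Delta>s = length Js" and "\<And>i. i < length Js \<Longrightarrow> FO_nabla S \<Sigma> (\<Delta>s ! i) (Js ! i)"
    and "FO_nabla S \<Sigma> (mset Js + \<Gamma>) J"
  shows "FO_nabla S \<Sigma> (sum_list \<Delta>s + \<Gamma>) J"
  using assms
proof (induction \<Delta>s Js arbitrary: \<Gamma> rule: list_induct2)
  case (Cons \<Delta> \<Delta>s I Is)
  have "FO_nabla S \<Sigma> (sum_list \<Delta>s + add_mset I \<Gamma>) J"
    using Cons.prems(1)[of "Suc i" for i] Cons.prems(2) by (intro Cons.IH) auto
  then show ?case using FO_cutL[of S \<Sigma> \<Delta> I] Cons.prems(1)[of 0] by (simp add: add.assoc)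
qed simp

lemma FO_imp_elim:
  assumes "FO_nabla S \<Sigma> {#} (\<sigma>, FImp B C)"
  shows "FO_nabla S \<Sigma> {#(\<sigma>, B)#} (\<sigma>, C)"
proof -
  have wf: "finite \<Sigma>" "wf_judgment S \<Sigma> (\<sigma>, FImp B C)" "wf_judgment S \<Sigma> (\<sigma>, B)"
    "wf_judgment S \<Sigma> (\<sigma>, C)"
    using FO_wf[OF assms] by (auto simp: wf_FO_def)
  have "FO_nabla S \<Sigma> {#(\<sigma>, FImp B C), (\<sigma>, B)#} (\<sigma>, C)"
    using wf by (intro FO_nabla.ImpL FO_nabla.id) (auto simp: wf_FO_def)
  then show ?thesis using FO_cutL[OF assms] by fastforce
qed

lemma FO_nab_elim: "finite \<Sigma> \<Longrightarrow> wf_judgment S \<Sigma> (\<tau> # \<sigma>, B) \<Longrightarrow>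
    FO_nabla S \<Sigma> {#(\<sigma>, FNab \<tau> B)#} (\<tau> # \<sigma>, B)"
  by (intro FO_nabla.NabL FO_id) (auto simp: wf_FO_def)

lemma FO_nab_intro: "finite \<Sigma> \<Longrightarrow> wf_judgment S \<Sigma> (\<tau> # \<sigma>, B) \<Longrightarrow>
    FO_nabla S \<Sigma> {#(\<tau> # \<sigma>, B)#} (\<sigma>, FNab \<tau> B)"
  by (intro FO_nabla.NabR FO_id) (auto simp: wf_FO_def)

text \<open>Moving the quantifier of the vacuous axiom into the local signature turns its two
  implications into adding and removing a local variable.\<close>

lemma FO_vacuous:
  assumes "finite \<Sigma>" and wf: "wf_judgment S \<Sigma> (\<sigma>, B)" "\<tau> \<in> nominal S"
  shows "FO_nabla S \<Sigma> {#(\<sigma>, B)#} (\<tau> # \<sigma>, ren Suc B)"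
    and "FO_nabla S \<Sigma> {#(\<tau> # \<sigma>, ren Suc B)#} (\<sigma>, B)"
proof -
  let ?N = "FNab \<tau> (ren Suc B)"
  have wfN: "wf_judgment S \<Sigma> (\<tau> # \<sigma>, ren Suc B)"
    using wf by (auto intro!: long_nf_ren(1)[where \<Delta> = \<sigma>])
  then have wfN': "wf_judgment S \<Sigma> (\<sigma>, FImp B ?N)" "wf_judgment S \<Sigma> (\<sigma>, FImp ?N B)"
    "wf_judgment S \<Sigma> (\<sigma>, FEquiv B ?N)"
    using wf by (auto simp: FEquiv_def)
  then have "FO_nabla S \<Sigma> {#} (\<sigma>, FEquiv B ?N)"
    using assms(1) by (intro FO_nabla.axiom nabla_axiom.vacuous) (simp add: wf_FO_def)
  moreover have "FO_nabla S \<Sigma> {#(\<sigma>, FEquiv B ?N)#} (\<sigma>, FImp B ?N)"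
    using wfN' assms(1) unfolding FEquiv_def
    by (intro FO_nabla.AndL1 FO_id) (auto simp: wf_FO_def)
  moreover have "FO_nabla S \<Sigma> {#(\<sigma>, FEquiv B ?N)#} (\<sigma>, FImp ?N B)"
    using wfN' assms(1) unfolding FEquiv_def
    by (intro FO_nabla.AndL2 FO_id) (auto simp: wf_FO_def)
  ultimately have "FO_nabla S \<Sigma> {#(\<sigma>, B)#} (\<sigma>, ?N)" "FO_nabla S \<Sigma> {#(\<sigma>, ?N)#} (\<sigma>, B)"
    by (auto intro: FO_imp_elim FO_trans)
  then show "FO_nabla S \<Sigma> {#(\<sigma>, B)#} (\<tau> # \<sigma>, ren Suc B)"
    and "FO_nabla S \<Sigma> {#(\<tau> # \<sigma>, ren Suc B)#} (\<sigma>, B)"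
    using FO_nab_elim[OF assms(1) wfN] FO_nab_intro[OF assms(1) wfN] FO_trans by blast+
qed

text \<open>The most recent local variable is the innermost quantifier, so
  \<open>\<rho> # \<tau> # \<sigma>\<close> closes to the left side of the axiom, and the right side
  is opened again into the exchanged signature.\<close>

lemma FO_exchange:
  fixes B :: "('b, 'k) tm"
  defines "B' \<equiv> ren (id(0 := 1, 1 := 0)) B"
  assumes fin: "finite \<Sigma>" and wf: "wf_judgment S \<Sigma> (\<rho> # \<tau> # \<sigma>, B)"
  shows "FO_nabla S \<Sigma> {#(\<rho> # \<tau> # \<sigma>, B)#} (\<tau> # \<rho> # \<sigma>, B')"
proof -
  have nf: "long_nf S (\<tau> # \<rho> # \<sigma>) B' Prop"
    unfolding B'_def
    by (rule long_nf_ren(1)[where \<Delta> = "\<rho> # \<tau> # \<sigma>"])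
      (use wf in \<open>auto simp: less_Suc_eq_0_disj\<close>)
  then have wf': "wf_judgment S \<Sigma> (\<tau> # \<rho> # \<sigma>, B')"
    using wf by (auto simp: B'_def)
  have wfn: "wf_judgment S \<Sigma> (\<tau> # \<sigma>, FNab \<rho> B)" "wf_judgment S \<Sigma> (\<rho> # \<sigma>, FNab \<tau> B')"
    using wf wf' by (simp_all only: wf_judgment_FNab)
  then have "wf_judgment S \<Sigma> (\<sigma>, FNab \<tau> (FNab \<rho> B))" "wf_judgment S \<Sigma> (\<sigma>, FNab \<rho> (FNab \<tau> B'))"
    by (simp_all only: wf_judgment_FNab)
  then have "FO_nabla S \<Sigma> {#} (\<sigma>, FImp (FNab \<tau> (FNab \<rho> B)) (FNab \<rho> (FNab \<tau> B')))"
    using fin nabla_axiom.exchange[of \<tau> \<rho> B, folded B'_def]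
    by (intro FO_nabla.axiom) (auto simp: wf_FO_def)
  then have "FO_nabla S \<Sigma> {#(\<sigma>, FNab \<tau> (FNab \<rho> B))#} (\<sigma>, FNab \<rho> (FNab \<tau> B'))"
    by (rule FO_imp_elim)
  then show ?thesis
    using FO_nab_intro[OF fin wf] FO_nab_intro[OF fin wfn(1)] FO_nab_elim[OF fin wf']
      FO_nab_elim[OF fin wfn(2)] FO_trans by meson
qed

section \<open>Independence of the local signature\<close>

definition abs_judgment :: "'b name list \<Rightarrow> ('b, 'k) tm \<Rightarrow> ('b, 'k) gjudgment" where
  "abs_judgment L F = (map snd L, abs_noms L F)"

definition nominal_list :: "('b, 'k) lang \<Rightarrow> 'b name list \<Rightarrow> bool" where
  "nominal_list S L \<longleftrightarrow> distinct L \<and> snd ` set L \<subseteq> nominal S"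

lemma nominal_list_Cons:
  "nominal_list S (a # L) \<longleftrightarrow> a \<notin> set L \<and> snd a \<in> nominal S \<and> nominal_list S L"
  by (auto simp: nominal_list_def)

lemma wf_abs_judgment:
  "formula S \<Sigma> F \<Longrightarrow> nominal_list S L \<Longrightarrow> supp F \<subseteq> set L \<Longrightarrow> wf_judgment S \<Sigma> (abs_judgment L F)"
  unfolding abs_judgment_def nominal_list_def using wf_judgment_abs_noms by blast

text \<open>Binds a nominal constant by nabla at the level of LG formulas, so that a statement about
  all formulas over a tail also covers the formulas that mention one more constant.\<close>

definition nab :: "'b name \<Rightarrow> ('b, 'k) tm \<Rightarrow> ('b, 'k) tm" where
  "nab a F = FNab (snd a) (abs_noms [a] F)"

lemma abs_judgment_nab: "abs_judgment L (nab a F) = (map snd L, FNab (snd a) (abs_noms (a # L) F))"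
  by (simp add: abs_judgment_def nab_def abs_noms_Cons[of a L])

lemma abs_judgment_Cons: "abs_judgment (a # L) F = (snd a # map snd L, abs_noms (a # L) F)"
  by (simp add: abs_judgment_def)

lemma formula_nab: "formula S \<Sigma> F \<Longrightarrow> snd a \<in> nominal S \<Longrightarrow> formula S \<Sigma> (nab a F)"
  using long_nf_gsub(1)[OF _ wt_subst_abs_leaf, of S F Prop "[a]"] fv_abs_noms[of "[a]" F]
  by (auto simp: formula_def nab_def abs_noms_def)

lemma supp_nab: "supp (nab a F) \<subseteq> supp F - {a}"
  using supp_abs_noms[of "[a]" F] by (simp add: nab_def)

text \<open>Restricted to formulas covered by both lists. This is why \<open>transport_trans\<close>
  asks the middle list to contain what the outer lists share.\<close>

definition transport ::
  "('b, 'k) lang \<Rightarrow> 'b name set \<Rightarrow> 'b name list \<Rightarrow> 'b name list \<Rightarrow> bool" where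
  "transport S \<Sigma> L L' \<longleftrightarrow> (\<forall>F. formula S \<Sigma> F \<and> supp F \<subseteq> set L \<and> supp F \<subseteq> set L' \<longrightarrow>
     FO_nabla S \<Sigma> {#abs_judgment L F#} (abs_judgment L' F))"

lemma transport_trans:
  "transport S \<Sigma> L L' \<Longrightarrow> transport S \<Sigma> L' L'' \<Longrightarrow> set L \<inter> set L'' \<subseteq> set L' \<Longrightarrow> transport S \<Sigma> L L''"
  unfolding transport_def by (meson FO_trans le_inf_iff order_trans)

lemma transport_refl: "finite \<Sigma> \<Longrightarrow> nominal_list S L \<Longrightarrow> transport S \<Sigma> L L"
  by (auto simp: transport_def intro!: FO_id wf_abs_judgment)

lemma transport_vacuous:
  assumes "finite \<Sigma>" "nominal_list S (a # L)"
  shows "transport S \<Sigma> L (a # L)" and "transport S \<Sigma> (a # L) L"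
proof -
  have *: "FO_nabla S \<Sigma> {#abs_judgment L F#} (abs_judgment (a # L) F) \<and>
      FO_nabla S \<Sigma> {#abs_judgment (a # L) F#} (abs_judgment L F)"
    if "formula S \<Sigma> F" "supp F \<subseteq> set L" for F
  proof -
    have a: "a \<notin> supp F" using that assms(2) by (auto simp: nominal_list_Cons)
    have wf: "wf_judgment S \<Sigma> (map snd L, abs_noms L F)"
      using wf_abs_judgment[OF that(1) _ that(2)] assms(2)
      by (simp add: nominal_list_Cons abs_judgment_def)
    show ?thesis using FO_vacuous[OF assms(1) wf, of "snd a"] assms(2)
      by (simp add: abs_judgment_def abs_noms_Cons_vacuous[OF a] nominal_list_Cons)
  qed
  then show "transport S \<Sigma> L (a # L)" and "transport S \<Sigma> (a # L) L"
    by (simp_all add: transport_def)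
qed

lemma transport_swap:
  assumes "finite \<Sigma>" "nominal_list S (a # b # L)"
  shows "transport S \<Sigma> (a # b # L) (b # a # L)"
  unfolding transport_def
proof (intro allI impI, elim conjE)
  fix F assume F: "formula S \<Sigma> F" "supp F \<subseteq> set (a # b # L)"
  have ab: "a \<noteq> b" using assms(2) by (auto simp: nominal_list_def)
  show "FO_nabla S \<Sigma> {#abs_judgment (a # b # L) F#} (abs_judgment (b # a # L) F)"
    using FO_exchange[OF assms(1), of S "snd a" "snd b" "map snd L" "abs_noms (a # b # L) F"]
      wf_abs_judgment[OF F(1) assms(2) F(2)]
    unfolding abs_noms_swap[OF ab] abs_judgment_def by simp
qed

text \<open>The common head is packed into the formula as a nabla, the tails are exchanged, and the
  head is unpacked.\<close>

lemma transport_Cons: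
  assumes "finite \<Sigma>" and L: "nominal_list S (a # L)" and L': "nominal_list S (a # L')"
    and "transport S \<Sigma> L L'"
  shows "transport S \<Sigma> (a # L) (a # L')"
  unfolding transport_def
proof (intro allI impI, elim conjE)
  fix F assume F: "formula S \<Sigma> F" "supp F \<subseteq> set (a # L)" "supp F \<subseteq> set (a # L')"
  have "FO_nabla S \<Sigma> {#abs_judgment L (nab a F)#} (abs_judgment L' (nab a F))"
    using assms(4) F L formula_nab[OF F(1), of a] supp_nab[of a F]
    by (auto simp: transport_def nominal_list_Cons)
  then show "FO_nabla S \<Sigma> {#abs_judgment (a # L) F#} (abs_judgment (a # L') F)"
    using FO_nab_intro[OF assms(1) wf_abs_judgment[OF F(1) L F(2), unfolded abs_judgment_Cons]]
      FO_nab_elim[OF assms(1) wf_abs_judgment[OF F(1) L' F(3), unfolded abs_judgment_Cons]]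
    unfolding abs_judgment_nab abs_judgment_Cons by (meson FO_trans)
qed

lemma transport_append:
  assumes "finite \<Sigma>" "nominal_list S (P @ L)"
  shows "transport S \<Sigma> L (P @ L) \<and> transport S \<Sigma> (P @ L) L"
  using assms(2)
proof (induction P)
  case Nil
  then show ?case using transport_refl[OF assms(1)] by simp
next
  case (Cons a P)
  then have "transport S \<Sigma> L (P @ L)" "transport S \<Sigma> (P @ L) L"
    by (simp_all add: nominal_list_Cons)
  then show ?case using transport_vacuous[OF assms(1), of S a "P @ L"] Cons.prems
    by (auto intro: transport_trans)
qed

lemma transport_move:
  assumes "finite \<Sigma>" "nominal_list S (a # P @ Q)"
  shows "transport S \<Sigma> (a # P @ Q) (P @ a # Q)"
  using assms(2)
proof (induction P)
  case Nil
  then show ?case using transport_refl[OF assms(1)] by simp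
next
  case (Cons b P)
  have 1: "transport S \<Sigma> (a # b # P @ Q) (b # a # P @ Q)"
    using Cons.prems by (intro transport_swap[OF assms(1)]) simp
  have "transport S \<Sigma> (b # a # P @ Q) (b # P @ a # Q)"
    using Cons by (intro transport_Cons[OF assms(1)]) (auto simp: nominal_list_def)
  then show ?case using 1 by (auto intro: transport_trans)
qed

text \<open>Insertion sort: the tail is rearranged by induction, then the head moves to its place by
  adjacent swaps.\<close>

lemma transport_perm:
  assumes "finite \<Sigma>" "nominal_list S L" "mset L = mset L'"
  shows "transport S \<Sigma> L L'"
  using assms(2,3)
proof (induction L arbitrary: L')
  case Nil
  then show ?case using transport_refl[OF assms(1)] by simp
next
  case (Cons a K)
  then obtain P Q where L': "L' = P @ a # Q"
    by (metis in_set_conv_decomp mset_eq_setD list.set_intros(1))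
  have m: "mset K = mset (P @ Q)" using Cons.prems(2) L' by simp
  then have PQ: "set K = set (P @ Q)" "distinct K \<longleftrightarrow> distinct (P @ Q)"
    using mset_eq_setD mset_eq_imp_distinct_iff by blast+
  have K: "nominal_list S K" using Cons.prems(1) by (simp add: nominal_list_Cons)
  have nPQ: "nominal_list S (a # P @ Q)"
    using Cons.prems(1) PQ by (auto simp: nominal_list_def)
  have "transport S \<Sigma> (a # K) (a # P @ Q)"
    by (rule transport_Cons[OF assms(1) Cons.prems(1) nPQ Cons.IH[OF K m]])
  moreover have "transport S \<Sigma> (a # P @ Q) L'"
    unfolding L' by (rule transport_move[OF assms(1) nPQ])
  ultimately show ?case using PQ by (auto simp: L' intro: transport_trans)
qed

text \<open>Each list is extended by the missing elements of the other; the extensions are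
  permutations of each other, and the surplus is finally removed.\<close>

lemma transport_nominal_lists:
  assumes fin: "finite \<Sigma>" and L: "nominal_list S L" "nominal_list S L'"
  shows "transport S \<Sigma> L L'"
proof -
  define P where "P = filter (\<lambda>x. x \<notin> set L) L'"
  define P' where "P' = filter (\<lambda>x. x \<notin> set L') L"
  have nom: "nominal_list S (P @ L)" "nominal_list S (P' @ L')"
    using L by (auto simp: nominal_list_def P_def P'_def)
  then have "mset (P @ L) = mset (P' @ L')"
    by (subst set_eq_iff_mset_eq_distinct[symmetric]) (auto simp: nominal_list_def P_def P'_def)
  then have "transport S \<Sigma> (P @ L) (P' @ L')" using transport_perm[OF fin nom(1)] by simp
  moreover have "transport S \<Sigma> L (P @ L)" "transport S \<Sigma> (P' @ L') L'"
    using transport_append[OF fin] nom by auto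
  ultimately have "transport S \<Sigma> L (P' @ L')" by (auto intro: transport_trans)
  then show ?thesis using \<open>transport S \<Sigma> (P' @ L') L'\<close> by (auto intro: transport_trans)
qed

text \<open>Normal forms of \<open>conv\<close>-equal formulas need not be compared: a vacuous quantifier over the
  inhabited type \<open>\<iota> \<rightarrow> \<iota>\<close> lets \<open>inst_nf\<close> replace one normal form by another, so that no uniqueness
  of normal forms is required.\<close>

lemma FO_conv:
  assumes fin: "finite \<Sigma>" and wf: "wf_judgment S \<Sigma> (\<sigma>, B)" "wf_judgment S \<Sigma> (\<sigma>, B')"
    and conv: "conv B B'"
  shows "FO_nabla S \<Sigma> {#(\<sigma>, B)#} (\<sigma>, B')"
proof -
  \<comment> \<open>Any base type will do. The arrow type over it is inhabited by the identity in
    every language, whereas the base type itself may have no closed term.\<close>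
  let ?\<iota> = "Base undefined :: 'a ty"
  let ?A = "FAll (?\<iota> \<rightarrow> ?\<iota>) (ren Suc B)"
  have wfA: "wf_judgment S \<Sigma> (\<sigma>, ?A)"
    using wf(1) by (auto intro!: long_nf_ren(1)[where \<Delta> = \<sigma>])
  obtain n where n: "(n, fns (rev \<sigma>) (?\<iota> \<rightarrow> ?\<iota>)) \<notin> \<Sigma>" using ex_fresh_index[OF fin] by blast
  let ?h = "(n, fns (rev \<sigma>) (?\<iota> \<rightarrow> ?\<iota>))"
  have "FO_nabla S (insert ?h \<Sigma>) {#(\<sigma>, B)#} (\<sigma>, B)"
    using fin wf(1) by (intro FO_id) auto
  then have 1: "FO_nabla S \<Sigma> {#(\<sigma>, B)#} (\<sigma>, ?A)"
    by (rule FO_nabla.AllR[OF _ HOL.refl n, rotated 2])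
      (use fin wf(1) wfA in \<open>simp_all add: wf_FO_def inst_nf_def conv.refl\<close>)
  have t: "local_term S \<Sigma> \<sigma> (Lam ?\<iota> (Bnd 0)) (?\<iota> \<rightarrow> ?\<iota>)"
    using typed.intros(1)[of 0 "?\<iota> # \<sigma>" S] by (auto simp: local_term_def intro: typed.intros)
  \<comment> \<open>The instance of the vacuous body is \<open>B\<close>, and the rule accepts any
    normal form convertible to it, in particular \<open>B'\<close>.\<close>
  have "FO_nabla S \<Sigma> {#(\<sigma>, ?A)#} (\<sigma>, B')"
    by (rule FO_nabla.AllL[where B' = B', OF _ t])
      (use fin wf wfA conv in \<open>auto simp: wf_FO_def inst_nf_def intro: FO_id\<close>)
  then show ?thesis using 1 FO_trans by blast
qed

lemma nominal_supp: "formula S \<Sigma> F \<Longrightarrow> snd ` supp F \<subseteq> nominal S"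
  unfolding formula_def using typed_supp nf_typed(1) by blast

lemma ex_nominal_list:
  assumes "finite A" "snd ` A \<subseteq> nominal S"
  obtains L where "nominal_list S L" "set L = A"
  using assms finite_distinct_list unfolding nominal_list_def by metis

text \<open>\<open>conv\<close> by itself does not relate the supports, so the change of formula
  takes place over a list \<open>M\<close> that covers both, with a transport before and
  after.\<close>

lemma FO_abs_judgment:
  assumes fin: "finite \<Sigma>" and F: "formula S \<Sigma> F" "formula S \<Sigma> F'" "conv F F'"
    and L: "nominal_list S L" "supp F \<subseteq> set L" "nominal_list S L'" "supp F' \<subseteq> set L'"
  shows "FO_nabla S \<Sigma> {#abs_judgment L F#} (abs_judgment L' F')"
proof -
  have "snd ` (supp F \<union> supp F') \<subseteq> nominal S"
    using nominal_supp[OF F(1)] nominal_supp[OF F(2)] by auto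
  then obtain M where M: "nominal_list S M" "set M = supp F \<union> supp F'"
    by (rule ex_nominal_list[rotated]) auto
  have "FO_nabla S \<Sigma> {#abs_judgment L F#} (abs_judgment M F)"
    using transport_nominal_lists[OF fin L(1) M(1)] F L M by (simp add: transport_def)
  moreover have "FO_nabla S \<Sigma> {#abs_judgment M F#} (abs_judgment M F')"
    using wf_abs_judgment[OF F(1) M(1)] wf_abs_judgment[OF F(2) M(1)] M(2) F(3)
    unfolding abs_judgment_def by (intro FO_conv[OF fin]) (auto simp: abs_noms_def intro: conv_gsub)
  moreover have "FO_nabla S \<Sigma> {#abs_judgment M F'#} (abs_judgment L' F')"
    using transport_nominal_lists[OF fin M(1) L(3)] F L M by (simp add: transport_def)
  ultimately show ?thesis using FO_trans by blast
qed

section \<open>Translating LG formulas to judgements\<close>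

definition supp_list :: "('b, 'k) tm \<Rightarrow> 'b name list" where
  "supp_list F = (SOME L. distinct L \<and> set L = supp F)"

definition to_FO :: "('b, 'k) tm \<Rightarrow> ('b, 'k) gjudgment" where
  "to_FO F = abs_judgment (supp_list F) F"

lemma supp_list: "distinct (supp_list F)" "set (supp_list F) = supp F"
proof -
  have "distinct (supp_list F) \<and> set (supp_list F) = supp F"
    unfolding supp_list_def by (rule someI_ex) (metis finite_distinct_list finite_supp)
  then show "distinct (supp_list F)" "set (supp_list F) = supp F" by auto
qed

lemma nominal_supp_list: "formula S \<Sigma> F \<Longrightarrow> nominal_list S (supp_list F)"
  using nominal_supp by (simp add: nominal_list_def supp_list)

lemma to_FO_closed: "supp F = {} \<Longrightarrow> to_FO F = ([], F)"
  using supp_list(2)[of F] by (simp add: to_FO_def abs_judgment_def)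

lemma wf_to_FO: "formula S \<Sigma> F \<Longrightarrow> wf_judgment S \<Sigma> (to_FO F)"
  unfolding to_FO_def by (rule wf_abs_judgment) (simp_all add: nominal_supp_list supp_list)

lemma wf_FO_to_FO: "wf_LG S \<Sigma> \<Gamma> C \<Longrightarrow> wf_FO S \<Sigma> (image_mset to_FO \<Gamma>) (to_FO C)"
  by (auto simp: wf_LG_def wf_FO_def wf_to_FO)

lemma FO_changeR:
  assumes "FO_nabla S \<Sigma> \<Gamma> (abs_judgment L F)" "finite \<Sigma>" "formula S \<Sigma> F" "formula S \<Sigma> F'"
    "conv F F'" "nominal_list S L" "supp F \<subseteq> set L" "nominal_list S L'" "supp F' \<subseteq> set L'"
  shows "FO_nabla S \<Sigma> \<Gamma> (abs_judgment L' F')"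
  using FO_trans[OF assms(1) FO_abs_judgment] assms(2-) by blast

lemma FO_changeL:
  assumes "FO_nabla S \<Sigma> (add_mset (abs_judgment L F) \<Gamma>) J" "finite \<Sigma>" "formula S \<Sigma> F"
    "formula S \<Sigma> F'" "conv F F'" "nominal_list S L" "supp F \<subseteq> set L" "nominal_list S L'"
    "supp F' \<subseteq> set L'"
  shows "FO_nabla S \<Sigma> (add_mset (abs_judgment L' F') \<Gamma>) J"
  using FO_replaceL[OF FO_abs_judgment assms(1)] assms(2-) conv.sym by blast

text \<open>Frees the translation from the arbitrary choice in \<open>supp_list\<close>, as is
  needed when the formulas of one rule must share a local signature.\<close>

lemma FO_to_abs:
  assumes "finite \<Sigma>" "formula S \<Sigma> F" "nominal_list S L" "supp F \<subseteq> set L"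
  shows FO_to_absR: "FO_nabla S \<Sigma> \<Gamma> (to_FO F) \<Longrightarrow> FO_nabla S \<Sigma> \<Gamma> (abs_judgment L F)"
    and FO_to_absL: "FO_nabla S \<Sigma> (add_mset (to_FO F) \<Gamma>) J \<Longrightarrow>
      FO_nabla S \<Sigma> (add_mset (abs_judgment L F) \<Gamma>) J"
    and FO_of_absR: "FO_nabla S \<Sigma> \<Gamma> (abs_judgment L F) \<Longrightarrow> FO_nabla S \<Sigma> \<Gamma> (to_FO F)"
    and FO_of_absL: "FO_nabla S \<Sigma> (add_mset (abs_judgment L F) \<Gamma>) J \<Longrightarrow>
      FO_nabla S \<Sigma> (add_mset (to_FO F) \<Gamma>) J"
  using assms nominal_supp_list[OF assms(2)] supp_list(2)[of F] unfolding to_FO_def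
  by (auto elim!: FO_changeR FO_changeL intro: conv.refl)

lemma abs_judgment_simps:
  "abs_judgment L (Log c \<cdot> B \<cdot> C) = (map snd L, Log c \<cdot> abs_noms L B \<cdot> abs_noms L C)"
  "abs_judgment L (Log c \<cdot> Lam \<tau> B) = (map snd L, Log c \<cdot> Lam \<tau> (gsub (up (abs_leaf L)) B))"
  "abs_judgment L (Log c) = (map snd L, Log c)"
  by (simp_all add: abs_judgment_def)

lemma supp_perm: "supp (perm \<pi> t) = \<pi> ` supp t"
  by (induction t) auto

lemma idx_map: "inj \<pi> \<Longrightarrow> idx (map \<pi> L) (\<pi> a) = idx L a"
  by (induction L) (auto simp: inj_eq)

lemma abs_noms_perm:
  assumes "inj \<pi>" "supp t \<subseteq> set L"
  shows "abs_noms (map \<pi> L) (perm \<pi> t) = abs_noms L t"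
  unfolding perm_as_gsub[of \<pi> t] abs_noms_def gsub_gsub
  by (rule gsub_cong) (use assms in \<open>auto simp: leaves_def idx_map\<close>)

text \<open>Transferring \<open>L\<close> along the inverse of \<open>\<pi>'\<close> after
  \<open>\<pi>\<close> leaves all positions unchanged. Formulas related by the identity rule of LG
  thus yield literally the same judgement, to which plain \<open>id\<close> applies.\<close>

lemma abs_judgment_perm:
  assumes \<pi>: "is_perm \<pi>" "is_perm \<pi>'" and eq: "perm \<pi> B = perm \<pi>' B'"
    and L: "nominal_list S L" "supp B \<subseteq> set L"
  obtains L' where "nominal_list S L'" "supp B' \<subseteq> set L'" "abs_judgment L' B' = abs_judgment L B"
proof
  let ?L = "map (inv \<pi>' \<circ> \<pi>) L"
  have bij: "bij \<pi>" "bij \<pi>'" using \<pi> by (auto simp: is_perm_def)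
  have snd_inv: "snd (inv \<pi>' a) = snd a" for a
    using \<pi>(2) bij surj_f_inv_f[OF bij_is_surj[OF bij(2)], of a] by (metis is_perm_def)
  have snd: "snd (inv \<pi>' (\<pi> a)) = snd a" for a
    using \<pi>(1) snd_inv unfolding is_perm_def by metis
  have inj: "inj (inv \<pi>' \<circ> \<pi>)"
    using bij by (simp add: bij_imp_bij_inv bij_is_inj inj_compose)
  show "nominal_list S ?L"
    using L(1) inj by (auto simp: nominal_list_def distinct_map snd intro: inj_on_subset)
  have "\<pi>' ` supp B' = \<pi> ` supp B" using arg_cong[OF eq, of supp] by (simp add: supp_perm)
  then have "supp B' = inv \<pi>' ` \<pi> ` supp B" using bij by (metis bij_is_inj image_inv_f_f)
  then show supp: "supp B' \<subseteq> set ?L" using L(2) by (auto simp: image_comp)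
  have map: "map \<pi>' ?L = map \<pi> L"
    using bij by (simp add: bij_is_surj surj_f_inv_f)
  have "abs_noms ?L B' = abs_noms L B"
    using abs_noms_perm[OF bij_is_inj[OF bij(2)] supp] abs_noms_perm[OF bij_is_inj[OF bij(1)] L(2)]
    unfolding map eq by metis
  then show "abs_judgment ?L B' = abs_judgment L B" by (simp add: abs_judgment_def snd)
qed

lemma inst_nf_abs_noms:
  assumes "inst_nf S [] B t B'"
  shows "inst_nf S (map snd L) (gsub (up (abs_leaf L)) B) (abs_noms L t) (abs_noms L B')"
  using assms long_nf_gsub(1)[OF _ wt_subst_abs_leaf]
  by (auto simp: inst_nf_def abs_noms_def simp flip: gsub_inst intro: conv_gsub)

lemma local_term_abs_noms:
  assumes "typed S [] t \<tau>" "fv t \<subseteq> \<Sigma>" "supp t \<subseteq> set L"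
  shows "local_term S \<Sigma> (map snd L) (abs_noms L t) \<tau>"
  using assms fv_abs_noms[of L t] supp_abs_noms[of L t]
    typed_gsub[OF assms(1) wt_subst_typed[OF wt_subst_abs_leaf]]
  by (auto simp: local_term_def abs_noms_def)

text \<open>Local signatures are listed most recent first while a raised variable takes the oldest
  variable first; the reversal makes \<open>h cs\<close> match exactly.\<close>

lemma abs_noms_raised:
  fixes cs :: "'b name list"
  assumes "distinct cs"
  shows "abs_noms (rev cs) (apps (Var h :: ('b, 'k) tm) (map Nom cs)) =
    apps (Var h) (local_vars (map snd (rev cs)))"
proof -
  have "map (idx L) L = [0..<length L]" if "distinct L" for L :: "'b name list"
    using that by (intro nth_equalityI) auto
  from this[of "rev cs"] assms have "map (idx (rev cs)) (rev cs) = [0..<length cs]" by simp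
  then have "map (idx (rev cs)) cs = rev [0..<length cs]" by (metis rev_map rev_rev_ident)
  then have "map (\<lambda>c. Bnd (idx (rev cs) c) :: ('b, 'k) tm) cs = map Bnd (rev [0..<length cs])"
    by (metis (no_types, lifting) map_map comp_def map_cong)
  then show ?thesis
    by (simp add: abs_noms_def gsub_apps local_vars_def comp_def cong: map_cong)
qed

text \<open>Over the signature \<open>rev cs\<close> both logics raise \<open>h\<close> over the
  same list. The given \<open>B'\<close> is traded for the explicit \<open>Bs\<close>, whose support
  is known to lie in \<open>cs\<close>.\<close>

lemma raised_to_FO:
  assumes B: "long_nf S [\<tau>] B Prop" "fv B \<subseteq> \<Sigma>" "snd ` supp B \<subseteq> nominal S"
    and cs: "distinct cs" "set cs = supp B"
    and h: "h = (n, fns (map snd cs) \<tau>)"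
    and B': "inst_nf S [] B (apps (Var h) (map Nom cs)) B'"
  obtains Bs where "formula S (insert h \<Sigma>) Bs" "supp Bs \<subseteq> set cs" "conv B' Bs"
    "inst_nf S (map snd (rev cs)) (gsub (up (abs_leaf (rev cs))) B)
       (apps (Var h) (local_vars (map snd (rev cs)))) (abs_noms (rev cs) Bs)"
proof
  let ?Bs = "nf_inst_raised B h cs"
  have nf: "inst_nf S [] B (apps (Var h) (map Nom cs)) ?Bs"
    by (rule inst_nf_raised[OF B(1) h]) (use cs B in auto)
  show "formula S (insert h \<Sigma>) ?Bs"
    using nf fv_nf_inst_raised[of B h cs] B(2) by (auto simp: formula_def inst_nf_def)
  show "supp ?Bs \<subseteq> set cs" using supp_nf_inst_raised[of B h cs] cs by auto
  show "conv B' ?Bs" using nf B' conv.sym conv.trans unfolding inst_nf_def by blast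
  show "inst_nf S (map snd (rev cs)) (gsub (up (abs_leaf (rev cs))) B)
       (apps (Var h) (local_vars (map snd (rev cs)))) (abs_noms (rev cs) ?Bs)"
    using inst_nf_abs_noms[OF nf, of "rev cs"] unfolding abs_noms_raised[OF cs(1)] .
qed


lemma LG_imp_FO_nabla:
  assumes "LG S \<Sigma> \<Gamma> C"
  shows "FO_nabla S \<Sigma> (image_mset to_FO \<Gamma>) (to_FO C)"
  using assms
proof (induction rule: LG.induct)
  case (id_perm \<Sigma> B \<Gamma> B' \<pi> \<pi>')
  have fin: "finite \<Sigma>" and B: "formula S \<Sigma> B" and B': "formula S \<Sigma> B'"
    using id_perm(1) by (auto simp: wf_LG_def)
  obtain L' where L': "nominal_list S L'" "supp B' \<subseteq> set L'"
    "abs_judgment L' B' = abs_judgment (supp_list B) B"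
    using abs_judgment_perm[OF id_perm(2-4) nominal_supp_list[OF B]] supp_list(2)[of B] by blast
  have "FO_nabla S \<Sigma> (image_mset to_FO (add_mset B \<Gamma>)) (abs_judgment L' B')"
    using wf_FO_to_FO[OF id_perm(1)] wf_abs_judgment[OF B' L'(1,2)]
    by (auto simp: L'(3) to_FO_def wf_FO_def intro: FO_nabla.id)
  then show ?case by (rule FO_of_absR[OF fin B' L'(1,2)])
next
  case (multicut \<Sigma> \<Delta>s \<Gamma> C Bs)
  have "FO_nabla S \<Sigma> (sum_list (map (image_mset to_FO) \<Delta>s) + image_mset to_FO \<Gamma>) (to_FO C)"
    by (rule FO_multicut[where Js = "map to_FO Bs"]) (use multicut in auto)
  moreover have "sum_list (map (image_mset to_FO) \<Delta>s) = image_mset to_FO (sum_list \<Delta>s)"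
    by (induction \<Delta>s) auto
  ultimately show ?case by simp
next
  case (contrL \<Sigma> B \<Gamma> C)
  then show ?case using wf_FO_to_FO[OF contrL(1)] by (auto intro: FO_nabla.contrL)
next
  case (FalseL \<Sigma> \<Gamma> C)
  then show ?case using wf_FO_to_FO[OF FalseL] by (auto simp: to_FO_closed intro: FO_nabla.FalseL)
next
  case (TrueR \<Sigma> \<Gamma>)
  then show ?case using wf_FO_to_FO[OF TrueR] by (auto simp: to_FO_closed intro: FO_nabla.TrueR)
next
  case (AndL1 \<Sigma> B D \<Gamma> C)
  let ?F = "FAnd B D"
  have fin: "finite \<Sigma>" and F: "formula S \<Sigma> ?F" "formula S \<Sigma> B"
    using AndL1(1) by (auto simp: wf_LG_def formula_def)
  note L = nominal_supp_list[OF F(1)] supp_list(2)[of ?F]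
  \<comment> \<open>A component may have smaller support than the compound, but the rule wants one
    local signature, so the premise is moved to that of \<open>?F\<close>; likewise for the other
    connectives.\<close>
  have "FO_nabla S \<Sigma> (add_mset (abs_judgment (supp_list ?F) B) (image_mset to_FO \<Gamma>)) (to_FO C)"
    using AndL1(3) F L by (intro FO_to_absL[OF fin]) auto
  then show ?case using wf_FO_to_FO[OF AndL1(1)]
    unfolding to_FO_def[of ?F] abs_judgment_simps image_mset_add_mset abs_judgment_def noms_simps
    by (intro FO_nabla.AndL1)
next
  case (AndL2 \<Sigma> B D \<Gamma> C)
  let ?F = "FAnd B D"
  have fin: "finite \<Sigma>" and F: "formula S \<Sigma> ?F" "formula S \<Sigma> D"
    using AndL2(1) by (auto simp: wf_LG_def formula_def)
  note L = nominal_supp_list[OF F(1)] supp_list(2)[of ?F]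
  have "FO_nabla S \<Sigma> (add_mset (abs_judgment (supp_list ?F) D) (image_mset to_FO \<Gamma>)) (to_FO C)"
    using AndL2(3) F L by (intro FO_to_absL[OF fin]) auto
  then show ?case using wf_FO_to_FO[OF AndL2(1)]
    unfolding to_FO_def[of ?F] abs_judgment_simps image_mset_add_mset abs_judgment_def noms_simps
    by (intro FO_nabla.AndL2)
next
  case (AndR \<Sigma> \<Gamma> B C)
  let ?F = "FAnd B C"
  have fin: "finite \<Sigma>" and F: "formula S \<Sigma> ?F" "formula S \<Sigma> B" "formula S \<Sigma> C"
    using AndR(1) by (auto simp: wf_LG_def formula_def)
  note L = nominal_supp_list[OF F(1)] supp_list(2)[of ?F]
  have "FO_nabla S \<Sigma> (image_mset to_FO \<Gamma>) (abs_judgment (supp_list ?F) B)"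
    "FO_nabla S \<Sigma> (image_mset to_FO \<Gamma>) (abs_judgment (supp_list ?F) C)"
    using AndR F L by (auto intro!: FO_to_absR[OF fin])
  then show ?case using wf_FO_to_FO[OF AndR(1)]
    unfolding to_FO_def[of ?F] abs_judgment_simps abs_judgment_def noms_simps by (intro FO_nabla.AndR)
next
  case (OrL \<Sigma> B D \<Gamma> C)
  let ?F = "FOr B D"
  have fin: "finite \<Sigma>" and F: "formula S \<Sigma> ?F" "formula S \<Sigma> B" "formula S \<Sigma> D"
    using OrL(1) by (auto simp: wf_LG_def formula_def)
  note L = nominal_supp_list[OF F(1)] supp_list(2)[of ?F]
  have "FO_nabla S \<Sigma> (add_mset (abs_judgment (supp_list ?F) B) (image_mset to_FO \<Gamma>)) (to_FO C)"
    "FO_nabla S \<Sigma> (add_mset (abs_judgment (supp_list ?F) D) (image_mset to_FO \<Gamma>)) (to_FO C)"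
    using OrL F L by (auto intro!: FO_to_absL[OF fin])
  then show ?case using wf_FO_to_FO[OF OrL(1)]
    unfolding to_FO_def[of ?F] abs_judgment_simps image_mset_add_mset abs_judgment_def noms_simps
    by (intro FO_nabla.OrL)
next
  case (OrR1 \<Sigma> \<Gamma> B C)
  let ?F = "FOr B C"
  have fin: "finite \<Sigma>" and F: "formula S \<Sigma> ?F" "formula S \<Sigma> B"
    using OrR1(1) by (auto simp: wf_LG_def formula_def)
  note L = nominal_supp_list[OF F(1)] supp_list(2)[of ?F]
  have "FO_nabla S \<Sigma> (image_mset to_FO \<Gamma>) (abs_judgment (supp_list ?F) B)"
    using OrR1 F L by (auto intro!: FO_to_absR[OF fin])
  then show ?case using wf_FO_to_FO[OF OrR1(1)]
    unfolding to_FO_def[of ?F] abs_judgment_simps abs_judgment_def noms_simps by (intro FO_nabla.OrR1)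
next
  case (OrR2 \<Sigma> \<Gamma> B C)
  let ?F = "FOr B C"
  have fin: "finite \<Sigma>" and F: "formula S \<Sigma> ?F" "formula S \<Sigma> C"
    using OrR2(1) by (auto simp: wf_LG_def formula_def)
  note L = nominal_supp_list[OF F(1)] supp_list(2)[of ?F]
  have "FO_nabla S \<Sigma> (image_mset to_FO \<Gamma>) (abs_judgment (supp_list ?F) C)"
    using OrR2 F L by (auto intro!: FO_to_absR[OF fin])
  then show ?case using wf_FO_to_FO[OF OrR2(1)]
    unfolding to_FO_def[of ?F] abs_judgment_simps abs_judgment_def noms_simps by (intro FO_nabla.OrR2)
next
  case (ImpL \<Sigma> B D \<Gamma> C)
  let ?F = "FImp B D"
  have fin: "finite \<Sigma>" and F: "formula S \<Sigma> ?F" "formula S \<Sigma> B" "formula S \<Sigma> D"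
    using ImpL(1) by (auto simp: wf_LG_def formula_def)
  note L = nominal_supp_list[OF F(1)] supp_list(2)[of ?F]
  have "FO_nabla S \<Sigma> (image_mset to_FO \<Gamma>) (abs_judgment (supp_list ?F) B)"
    using ImpL F L by (auto intro!: FO_to_absR[OF fin])
  moreover have
    "FO_nabla S \<Sigma> (add_mset (abs_judgment (supp_list ?F) D) (image_mset to_FO \<Gamma>)) (to_FO C)"
    using ImpL F L by (auto intro!: FO_to_absL[OF fin])
  ultimately show ?case using wf_FO_to_FO[OF ImpL(1)]
    unfolding to_FO_def[of ?F] abs_judgment_simps image_mset_add_mset abs_judgment_def noms_simps
    by (intro FO_nabla.ImpL)
next
  case (ImpR \<Sigma> \<Gamma> B C)
  let ?F = "FImp B C"
  have fin: "finite \<Sigma>" and F: "formula S \<Sigma> ?F" "formula S \<Sigma> B" "formula S \<Sigma> C"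
    using ImpR(1) by (auto simp: wf_LG_def formula_def)
  note L = nominal_supp_list[OF F(1)] supp_list(2)[of ?F]
  have "FO_nabla S \<Sigma> (add_mset (abs_judgment (supp_list ?F) B) (image_mset to_FO \<Gamma>))
      (abs_judgment (supp_list ?F) C)"
    using ImpR F L by (auto intro!: FO_to_absR[OF fin] FO_to_absL[OF fin])
  then show ?case using wf_FO_to_FO[OF ImpR(1)]
    unfolding to_FO_def[of ?F] abs_judgment_simps abs_judgment_def noms_simps by (intro FO_nabla.ImpR)
next
  case (AllL \<Sigma> \<tau> B \<Gamma> C t B')
  let ?F = "FAll \<tau> B"
  have fin: "finite \<Sigma>" and F: "formula S \<Sigma> ?F" "formula S \<Sigma> B'"
    using AllL(1) LG_wf[OF AllL(5)] by (auto simp: wf_LG_def)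
  \<comment> \<open>The witness \<open>t\<close> may mention constants outside the support of
    \<open>B\<close>, so the common signature has to cover it as well.\<close>
  have "snd ` (supp B \<union> supp t \<union> supp B') \<subseteq> nominal S"
    using nominal_supp[OF F(1)] nominal_supp[OF F(2)] typed_supp[OF AllL(2)] by auto
  then obtain L where L: "nominal_list S L" "set L = supp B \<union> supp t \<union> supp B'"
    by (rule ex_nominal_list[rotated]) auto
  have "FO_nabla S \<Sigma> (add_mset (abs_judgment L B') (image_mset to_FO \<Gamma>)) (to_FO C)"
    using AllL(6) F L by (auto intro!: FO_to_absL[OF fin])
  then have "FO_nabla S \<Sigma> (add_mset (abs_judgment L ?F) (image_mset to_FO \<Gamma>)) (to_FO C)"
    unfolding abs_judgment_simps abs_judgment_def[of L B']
    by (rule FO_nabla.AllL[OF _ local_term_abs_noms[OF AllL(2,3)] inst_nf_abs_noms[OF AllL(4)],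
        rotated 2])
      (use wf_FO_to_FO[OF AllL(1)] wf_abs_judgment[OF F(1) L(1)] L(2) in
        \<open>auto simp: wf_FO_def abs_judgment_def\<close>)
  then show ?case using F L unfolding image_mset_add_mset by (intro FO_of_absL[OF fin]) auto
next
  case (AllR \<Sigma> \<Gamma> \<tau> B cs h n B')
  let ?F = "FAll \<tau> B"
  have fin: "finite \<Sigma>" and F: "formula S \<Sigma> ?F" and B': "formula S (insert h \<Sigma>) B'"
    using AllR(1) LG_wf[OF AllR(7)] by (auto simp: wf_LG_def)
  have B: "long_nf S [\<tau>] B Prop" "fv B \<subseteq> \<Sigma>" "snd ` supp B \<subseteq> nominal S"
    using F nominal_supp[OF F] by (auto simp: formula_def)
  obtain Bs where Bs: "formula S (insert h \<Sigma>) Bs" "supp Bs \<subseteq> set cs" "conv B' Bs"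
    and nf: "inst_nf S (map snd (rev cs)) (gsub (up (abs_leaf (rev cs))) B)
       (apps (Var h) (local_vars (map snd (rev cs)))) (abs_noms (rev cs) Bs)"
    by (rule raised_to_FO[OF B AllR(2-4,6)])
  \<comment> \<open>Here the local signature is dictated by the eigenvariable: its arguments, most
    recent first.\<close>
  have L: "nominal_list S (rev cs)" using AllR(2,3) B(3) by (auto simp: nominal_list_def)
  have "FO_nabla S (insert h \<Sigma>) (image_mset to_FO \<Gamma>) (abs_judgment (rev cs) Bs)"
    using AllR(8)[unfolded to_FO_def[of B']] fin B' Bs L nominal_supp_list[OF B'] supp_list(2)[of B']
    by (auto elim!: FO_changeR)
  moreover have "h = (n, fns (rev (map snd (rev cs))) \<tau>)" using AllR(4) by (simp add: rev_map)
  ultimately have "FO_nabla S \<Sigma> (image_mset to_FO \<Gamma>) (abs_judgment (rev cs) ?F)"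
    unfolding abs_judgment_simps abs_judgment_def[of _ Bs]
    using wf_FO_to_FO[OF AllR(1)] wf_abs_judgment[OF F L] AllR(3,5) nf
    by (intro FO_nabla.AllR) (auto simp: wf_FO_def abs_judgment_def)
  then show ?case using F L AllR(3) by (intro FO_of_absR[OF fin]) auto
next
  case (ExL \<Sigma> \<tau> B \<Gamma> C cs h n B')
  let ?F = "FEx \<tau> B"
  have fin: "finite \<Sigma>" and F: "formula S \<Sigma> ?F" and B': "formula S (insert h \<Sigma>) B'"
    using ExL(1) LG_wf[OF ExL(7)] by (auto simp: wf_LG_def)
  have B: "long_nf S [\<tau>] B Prop" "fv B \<subseteq> \<Sigma>" "snd ` supp B \<subseteq> nominal S"
    using F nominal_supp[OF F] by (auto simp: formula_def)
  obtain Bs where Bs: "formula S (insert h \<Sigma>) Bs" "supp Bs \<subseteq> set cs" "conv B' Bs"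
    and nf: "inst_nf S (map snd (rev cs)) (gsub (up (abs_leaf (rev cs))) B)
       (apps (Var h) (local_vars (map snd (rev cs)))) (abs_noms (rev cs) Bs)"
    by (rule raised_to_FO[OF B ExL(2-4,6)])
  have L: "nominal_list S (rev cs)" using ExL(2,3) B(3) by (auto simp: nominal_list_def)
  have "FO_nabla S (insert h \<Sigma>) (add_mset (abs_judgment (rev cs) Bs) (image_mset to_FO \<Gamma>)) (to_FO C)"
    using ExL(8)[unfolded image_mset_add_mset to_FO_def[of B']] fin B' Bs L nominal_supp_list[OF B']
      supp_list(2)[of B']
    by (auto elim!: FO_changeL)
  moreover have "h = (n, fns (rev (map snd (rev cs))) \<tau>)" using ExL(4) by (simp add: rev_map)
  ultimately have "FO_nabla S \<Sigma> (add_mset (abs_judgment (rev cs) ?F) (image_mset to_FO \<Gamma>)) (to_FO C)"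
    unfolding abs_judgment_simps abs_judgment_def[of _ Bs]
    using wf_FO_to_FO[OF ExL(1)] wf_abs_judgment[OF F L] ExL(3,5) nf
    by (intro FO_nabla.ExL) (auto simp: wf_FO_def abs_judgment_def)
  then show ?case using F L ExL(3) unfolding image_mset_add_mset
    by (intro FO_of_absL[OF fin]) auto
next
  case (ExR \<Sigma> \<Gamma> \<tau> B t B')
  let ?F = "FEx \<tau> B"
  have fin: "finite \<Sigma>" and F: "formula S \<Sigma> ?F" "formula S \<Sigma> B'"
    using ExR(1) LG_wf[OF ExR(5)] by (auto simp: wf_LG_def)
  have "snd ` (supp B \<union> supp t \<union> supp B') \<subseteq> nominal S"
    using nominal_supp[OF F(1)] nominal_supp[OF F(2)] typed_supp[OF ExR(2)] by auto
  then obtain L where L: "nominal_list S L" "set L = supp B \<union> supp t \<union> supp B'"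
    by (rule ex_nominal_list[rotated]) auto
  have "FO_nabla S \<Sigma> (image_mset to_FO \<Gamma>) (abs_judgment L B')"
    using ExR(6) F L by (auto intro!: FO_to_absR[OF fin])
  then have "FO_nabla S \<Sigma> (image_mset to_FO \<Gamma>) (abs_judgment L ?F)"
    unfolding abs_judgment_simps abs_judgment_def[of L B']
    by (rule FO_nabla.ExR[OF _ local_term_abs_noms[OF ExR(2,3)] inst_nf_abs_noms[OF ExR(4)],
        rotated 2])
      (use wf_FO_to_FO[OF ExR(1)] wf_abs_judgment[OF F(1) L(1)] L(2) in
        \<open>auto simp: wf_FO_def abs_judgment_def\<close>)
  then show ?case using F L by (intro FO_of_absR[OF fin]) auto
next
  case (NabL \<Sigma> \<tau> B \<Gamma> C n)
  let ?F = "FNab \<tau> B" and ?B = "inst B (Nom (n, \<tau>))"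
  have fin: "finite \<Sigma>" and F: "formula S \<Sigma> ?F" "formula S \<Sigma> ?B" and \<tau>: "\<tau> \<in> nominal S"
    using NabL(1) LG_wf[OF NabL(3)] by (auto simp: wf_LG_def formula_def)
  \<comment> \<open>The fresh constant goes to the front, as the most recent local variable, even if
    it does not occur in the instance.\<close>
  have L: "nominal_list S ((n, \<tau>) # supp_list ?F)"
    using nominal_supp_list[OF F(1)] supp_list(2)[of ?F] NabL(2) \<tau> by (simp add: nominal_list_Cons)
  have "FO_nabla S \<Sigma> (add_mset (abs_judgment ((n, \<tau>) # supp_list ?F) ?B) (image_mset to_FO \<Gamma>))
      (to_FO C)"
    using NabL(4) F L inst_supp[of B "Nom (n, \<tau>)"] supp_list(2)[of ?F]
    by (intro FO_to_absL[OF fin]) auto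
  then show ?case using wf_FO_to_FO[OF NabL(1)]
    unfolding to_FO_def[of ?F] abs_judgment_simps image_mset_add_mset abs_judgment_Cons
      abs_noms_inst[OF NabL(2)] snd_conv
    by (intro FO_nabla.NabL)
next
  case (NabR \<Sigma> \<Gamma> \<tau> B n)
  let ?F = "FNab \<tau> B" and ?B = "inst B (Nom (n, \<tau>))"
  have fin: "finite \<Sigma>" and F: "formula S \<Sigma> ?F" "formula S \<Sigma> ?B" and \<tau>: "\<tau> \<in> nominal S"
    using NabR(1) LG_wf[OF NabR(3)] by (auto simp: wf_LG_def formula_def)
  have L: "nominal_list S ((n, \<tau>) # supp_list ?F)"
    using nominal_supp_list[OF F(1)] supp_list(2)[of ?F] NabR(2) \<tau> by (simp add: nominal_list_Cons)
  have "FO_nabla S \<Sigma> (image_mset to_FO \<Gamma>) (abs_judgment ((n, \<tau>) # supp_list ?F) ?B)"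
    using NabR(4) F L inst_supp[of B "Nom (n, \<tau>)"] supp_list(2)[of ?F]
    by (intro FO_to_absR[OF fin]) auto
  then show ?case using wf_FO_to_FO[OF NabR(1)]
    unfolding to_FO_def[of ?F] abs_judgment_simps abs_judgment_Cons
      abs_noms_inst[OF NabR(2)] snd_conv
    by (intro FO_nabla.NabR)
qed

text \<open>Without nominal constants and with an empty local signature both translations fix
  \<open>F\<close>, so the two inductions meet in the same end sequent.\<close>

theorem theorem2:
  fixes S :: "('b, 'k) lang" and \<Sigma> :: "'b name set" and F :: "('b, 'k) tm"
  assumes "wf_lang S"
    and "finite \<Sigma>"
    and "formula S \<Sigma> F"
    and "supp F = {}"
  shows "FO_nabla_provable S \<Sigma> F \<longleftrightarrow> LG_provable S \<Sigma> F"
proof -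
  have "to_LG ([], F) = F" by (simp add: to_LG_def)
  then show ?thesis
    using FO_nabla_imp_LG[OF _ assms(1), of \<Sigma> "{#}" "([], F)"] LG_imp_FO_nabla[of S \<Sigma> "{#}" F]
    unfolding FO_nabla_provable_def LG_provable_def to_FO_closed[OF assms(4)] by auto
qed

end
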